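(* Let $\mathcal{S}\subseteq\mathbb{A}_k^q$ be constructible, let $U=\mathfrak{m}^l\cdot\mathcal{C}^m$ be an $\mathfrak{m}$-adic neighbourhood of $0$, and let $f_{\mathcal{S}}\colon\mathcal{S}\times U\to\mathcal{C}^m$ be a regular family of textile maps over $\mathcal{S}$ with $f_{\mathcal{S}}(-,0)=0$. Assume $f_{\mathcal{S}}=\ell_{\mathcal{S}}+h_{\mathcal{S}}$ with values in a neighbourhood $W\subseteq\mathcal{C}^m$ of $0$, where $\ell_{\mathcal{S}}\colon\mathcal{S}\times U\to W$ is a linear regular family with inverse $\tilde\ell_{\mathcal{S}}\colon\mathcal{S}\times W\to U$. If $\tilde\ell_{\mathcal{S}}\circ h_{\mathcal{S}}$ is contractive on $U$, then $f_{\mathcal{S}}$ admits on $U$ a (right) inverse, i.e. there is a regular family $g_{\mathcal{S}}$ over $\mathcal{S}$ with values in $\mathcal{C}^m$, defined on pairs $(s,c)$ with $s\in\mathcal{S}$ and $c\in f_s(U)$, such that $f_{\mathcal{S}}\circ g_{\mathcal{S}}=\mathrm{id}_{\mathcal{S}}$.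
   Context: Let $k$ be a field of characteristic $0$, $n\ge1$. $\mathcal{C}$ is the space of cords $(c_\alpha)_{\alpha\in\mathbb{N}^n}$ in $k$ ($\mathbb N\ni 0$), identified with $k[[x_1,\dots,x_n]]$, with maximal ideal $\mathfrak{m}$; $\mathrm{ord}$ of an element of $\mathcal{C}^m$ is the minimum of the orders of its components. $\mathcal{C}^m$ carries the $\mathfrak{m}$-adic topology (basic $0$-neighbourhoods $\mathfrak{m}^l\cdot\mathcal{C}^m$); $W$ is a linear subspace that is a neighbourhood of $0$. Regular families: for $Y\subseteq\mathcal{C}^m$ a map $\mathcal{S}\times Y\to k$ is a regular $k$-valued family if it is the restriction of a function $g\colon Z\times Y\to k$, with $Z\subseteq\mathbb{A}_k^q$ a subvariety containing $\mathcal{S}$, that is locally (in the Zariski topology) a quotient of two polynomials in the coordinates $s_1,\dots,s_q$ and (finitely many of) the coefficients of the cord variable, the denominator being locally nonvanishing. A regular family of textile maps over $\mathcal{S}$ on $Y$ is a map $f_{\mathcal{S}}\colon\mathcal{S}\times Y\to\mathcal{C}^p$ all of whose coefficients are regular $k$-valued families; $f_s:=f_{\mathcal{S}}(s,-)$. It is linear if every $f_s$ is linear. Composition is pointwise in $s$: $(f_{\mathcal{S}}\circ g_{\mathcal{S}})_s=f_s\circ g_s$; $\mathrm{id}_{\mathcal{S}}$ is the family all of whose members are the identity. An inverse of a regular family $f_{\mathcal{S}}$ is a regular family $g_{\mathcal{S}}$ with $f_{\mathcal{S}}\circ g_{\mathcal{S}}=\mathrm{id}_{\mathcal{S}}$.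 A family $f_{\mathcal{S}}$ is contractive on $U$ if for all $s\in\mathcal{S}$ and all $a\ne b$ in $U$: $\mathrm{ord}(f_s(a)-f_s(b))>\mathrm{ord}(a-b)$. *)

theory Defs
  imports
    "HOL-Analysis.Abstract_Topology"
    "HOL-Library.Function_Algebras"
    "HOL-Library.Extended_Nat"
begin

section \<open>Cords\<close>

text \<open>
  The index types \<open>'n\<close> and \<open>'m\<close> (of class \<open>finite\<close>) have \<open>n \<ge> 1\<close> and \<open>m \<ge> 1\<close> elements.
  Multi-indices are functions \<open>'n \<Rightarrow> nat\<close>; addition, difference and zero on multi-indices, cords
  and tuples of cords are the pointwise ones of \<^theory>\<open>HOL-Library.Function_Algebras\<close>. The pointwise
  product of that theory is \<^emph>\<open>not\<close> the product of power series and is never used on cords.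
\<close>

type_synonym ('n, 'k) cord = "('n \<Rightarrow> nat) \<Rightarrow> 'k"
type_synonym ('m, 'n, 'k) cords = "'m \<Rightarrow> ('n, 'k) cord"

definition cord_mult :: "('n::finite, 'k::field) cord \<Rightarrow> ('n, 'k) cord \<Rightarrow> ('n, 'k) cord" where
  "cord_mult c d = (\<lambda>\<gamma>. \<Sum>(\<alpha>, \<beta>) \<in> {(\<alpha>, \<beta>). \<alpha> + \<beta> = \<gamma>}. c \<alpha> * d \<beta>)"

definition max_ideal :: "('n::finite, 'k::field) cord set" where
  "max_ideal = {c. c 0 = 0}"

definition max_ideal_times ::
    "('m, 'n::finite, 'k::field) cords set \<Rightarrow> ('m, 'n, 'k) cords set" where
  "max_ideal_times M =
    {(\<Sum>j<N. (\<lambda>i. cord_mult (c j) (v j i))) | (N::nat) c v. \<forall>j<N. c j \<in> max_ideal \<and> v j \<in> M}"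

text \<open>\<open>madic l\<close> is the submodule \<open>\<mm>\<^sup>l \<cdot> \<C>\<^sup>m\<close>, written as \<open>\<mm> \<cdot> (\<mm> \<cdot> (\<dots> \<cdot> \<C>\<^sup>m))\<close>.\<close>

definition madic :: "nat \<Rightarrow> ('m, 'n::finite, 'k::field) cords set" where
  "madic l = (max_ideal_times ^^ l) UNIV"

definition madic_nbhd_0 :: "('m, 'n::finite, 'k::field) cords set \<Rightarrow> bool" where
  "madic_nbhd_0 W \<longleftrightarrow> (\<exists>l. madic l \<subseteq> W)"

text \<open>The order of the zero cord is \<open>\<infinity>\<close>, the infimum of the empty set.\<close>

definition cord_ord :: "('n::finite, 'k::field) cord \<Rightarrow> enat" where
  "cord_ord c = (INF \<alpha>\<in>{\<alpha>. c \<alpha> \<noteq> 0}. enat (\<Sum>i\<in>UNIV. \<alpha> i))"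

definition cords_ord :: "('m::finite, 'n::finite, 'k::field) cords \<Rightarrow> enat" where
  "cords_ord a = Min (range (\<lambda>i. cord_ord (a i)))"

definition cords_scale :: "'k::field \<Rightarrow> ('m, 'n, 'k) cords \<Rightarrow> ('m, 'n, 'k) cords" where
  "cords_scale r a = (\<lambda>i \<alpha>. r * a i \<alpha>)"

global_interpretation cords: vector_space cords_scale
  by unfold_locales (auto simp: cords_scale_def fun_eq_iff algebra_simps)

definition linear_on ::
    "('m, 'n, 'k::field) cords set \<Rightarrow> (('m, 'n, 'k) cords \<Rightarrow> ('p, 'n, 'k) cords) \<Rightarrow> bool" where
  "linear_on V f \<longleftrightarrow>
     (\<forall>a\<in>V. \<forall>b\<in>V. f (a + b) = f a + f b) \<and> (\<forall>r. \<forall>a\<in>V. f (cords_scale r a) = cords_scale r (f a))"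


section \<open>Zariski topology\<close>

text \<open>
  Polynomial functions in coordinates indexed by an arbitrary, possibly infinite, type; each of
  them involves only finitely many coordinates. Since the fields used are infinite, polynomials and
  polynomial functions are the same thing.
\<close>

inductive_set poly_funs :: "(('v \<Rightarrow> 'k::field) \<Rightarrow> 'k) set" where
  const: "(\<lambda>_. r) \<in> poly_funs"
| coord: "(\<lambda>x. x v) \<in> poly_funs"
| add: "f \<in> poly_funs \<Longrightarrow> g \<in> poly_funs \<Longrightarrow> (\<lambda>x. f x + g x) \<in> poly_funs"
| mult: "f \<in> poly_funs \<Longrightarrow> g \<in> poly_funs \<Longrightarrow> (\<lambda>x. f x * g x) \<in> poly_funs"

definition zariski :: "('v \<Rightarrow> 'k::field) topology" where
  "zariski = topology (\<lambda>X. \<exists>P \<subseteq> poly_funs. X = {x. \<exists>p\<in>P. p x \<noteq> 0})"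

lemma openin_zariski:
  "openin zariski X \<longleftrightarrow> (\<exists>P \<subseteq> poly_funs. X = {x :: 'v \<Rightarrow> 'k::field. \<exists>p\<in>P. p x \<noteq> 0})"
proof -
  let ?O = "\<lambda>X. \<exists>P \<subseteq> poly_funs. X = {x :: 'v \<Rightarrow> 'k. \<exists>p\<in>P. p x \<noteq> 0}"
  have "istopology ?O"
    unfolding istopology_def
  proof (intro conjI allI impI)
    fix X Y assume "?O X" "?O Y"
    then obtain P Q where P: "P \<subseteq> poly_funs" "X = {x. \<exists>p\<in>P. p x \<noteq> 0}"
      and Q: "Q \<subseteq> poly_funs" "Y = {x. \<exists>p\<in>Q. p x \<noteq> 0}"
      by blast
    let ?R = "{\<lambda>x. p x * q x | p q. p \<in> P \<and> q \<in> Q}"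
    have "?R \<subseteq> poly_funs"
      using P(1) Q(1) by (auto intro!: poly_funs.mult)
    moreover have "X \<inter> Y = {x. \<exists>p\<in>?R. p x \<noteq> 0}"
    proof (rule set_eqI)
      fix x
      have "x \<in> X \<inter> Y \<longleftrightarrow> (\<exists>p\<in>P. \<exists>q\<in>Q. p x * q x \<noteq> 0)"
        unfolding P(2) Q(2) by (simp add: mult_eq_0_iff)
      then show "x \<in> X \<inter> Y \<longleftrightarrow> x \<in> {x. \<exists>p\<in>?R. p x \<noteq> 0}" by fast
    qed
    ultimately show "?O (X \<inter> Y)"
      by (intro exI[of _ ?R] conjI)
  next
    fix K assume K: "\<forall>X\<in>K. ?O X"
    let ?R = "{p \<in> poly_funs. {x. p x \<noteq> 0} \<subseteq> \<Union>K}"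
    have "\<Union>K \<subseteq> {x. \<exists>p\<in>?R. p x \<noteq> 0}"
    proof
      fix x assume "x \<in> \<Union>K"
      then obtain X where X: "X \<in> K" "x \<in> X" by blast
      with K obtain P where P: "P \<subseteq> poly_funs" "X = {x. \<exists>p\<in>P. p x \<noteq> 0}" by blast
      with X obtain p where p: "p \<in> P" "p x \<noteq> 0" by blast
      have "{x. p x \<noteq> 0} \<subseteq> X" using P p by blast
      then have "p \<in> ?R" using X P p by blast
      with p show "x \<in> {x. \<exists>p\<in>?R. p x \<noteq> 0}" by blast
    qed
    moreover have "{x. \<exists>p\<in>?R. p x \<noteq> 0} \<subseteq> \<Union>K" by auto
    ultimately have "\<Union>K = {x. \<exists>p\<in>?R. p x \<noteq> 0}" by (rule equalityI)
    then show "?O (\<Union>K)"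
      by (intro exI[of _ ?R] conjI) simp_all
  qed
  then show ?thesis
    unfolding zariski_def by (simp add: topology_inverse')
qed

definition zariski_regular :: "('v \<Rightarrow> 'k::field) set \<Rightarrow> (('v \<Rightarrow> 'k) \<Rightarrow> 'k) \<Rightarrow> bool" where
  "zariski_regular X \<phi> \<longleftrightarrow>
     (\<forall>x\<in>X. \<exists>G P Q. openin (subtopology zariski X) G \<and> x \<in> G \<and> P \<in> poly_funs \<and> Q \<in> poly_funs \<and>
        (\<forall>y\<in>G. Q y \<noteq> 0 \<and> \<phi> y = P y / Q y))"

text \<open>The affine space \<open>\<A>\<^sup>q\<close> (its \<open>k\<close>-points, \<open>q = 0\<close> allowed): sequences vanishing from index \<open>q\<close> on.\<close>

definition affine_space :: "nat \<Rightarrow> (nat \<Rightarrow> 'k::field) set" where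
  "affine_space q = {s. \<forall>i\<ge>q. s i = 0}"

text \<open>Subvarieties are locally closed, neither irreducible nor necessarily closed.\<close>

definition subvariety :: "nat \<Rightarrow> (nat \<Rightarrow> 'k::field) set \<Rightarrow> bool" where
  "subvariety q Z \<longleftrightarrow>
     (\<exists>C G. closedin (subtopology zariski (affine_space q)) C \<and>
            openin (subtopology zariski (affine_space q)) G \<and> Z = C \<inter> G)"

definition constructible :: "nat \<Rightarrow> (nat \<Rightarrow> 'k::field) set \<Rightarrow> bool" where
  "constructible q S \<longleftrightarrow> (\<exists>\<Z>. finite \<Z> \<and> (\<forall>Z\<in>\<Z>. subvariety q Z) \<and> S = \<Union>\<Z>)"


section \<open>Regular families\<close>

text \<open>
  A pair \<open>(s, a)\<close> of a parameter and a tuple of cords, as the point whose coordinates are the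
  \<open>s\<^sub>i\<close> and all the coefficients of \<open>a\<close>.
\<close>

definition coords ::
    "(nat \<Rightarrow> 'k) \<times> ('m, 'n, 'k::field) cords \<Rightarrow> nat + 'm \<times> ('n \<Rightarrow> nat) \<Rightarrow> 'k" where
  "coords = (\<lambda>(s, a). case_sum s (\<lambda>(i, \<alpha>). a i \<alpha>))"

text \<open>
  The domain \<open>D\<close> is a set of pairs. For \<open>D = S \<times> Y\<close> with nonempty \<open>Y\<close>, where \<open>fst ` D = S\<close> and
  \<open>snd ` D = Y\<close> (or everything is empty), this asks for an extension of \<open>\<phi>\<close> to \<open>Z \<times> Y\<close> with
  \<open>S \<subseteq> Z\<close>. For other \<open>D\<close> the set \<open>Y\<close> is taken to be the projection of \<open>D\<close>.
\<close>

definition regular_scalar_family ::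
    "nat \<Rightarrow> ((nat \<Rightarrow> 'k) \<times> ('m, 'n, 'k::field) cords) set
      \<Rightarrow> ((nat \<Rightarrow> 'k) \<Rightarrow> ('m, 'n, 'k) cords \<Rightarrow> 'k) \<Rightarrow> bool" where
  "regular_scalar_family q D \<phi> \<longleftrightarrow>
     (\<exists>Z \<gamma>. subvariety q Z \<and> fst ` D \<subseteq> Z \<and> zariski_regular (coords ` (Z \<times> snd ` D)) \<gamma> \<and>
        (\<forall>(s, a)\<in>D. \<phi> s a = \<gamma> (coords (s, a))))"

definition regular_family ::
    "nat \<Rightarrow> ((nat \<Rightarrow> 'k) \<times> ('m, 'n, 'k::field) cords) set
      \<Rightarrow> ((nat \<Rightarrow> 'k) \<Rightarrow> ('m, 'n, 'k) cords \<Rightarrow> ('p, 'n, 'k) cords) \<Rightarrow> bool" where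
  "regular_family q D f \<longleftrightarrow> (\<forall>i \<alpha>. regular_scalar_family q D (\<lambda>s a. f s a i \<alpha>))"

definition right_inverse_family ::
    "(nat \<Rightarrow> 'k) set \<Rightarrow> ('m, 'n, 'k::field) cords set \<Rightarrow> ((nat \<Rightarrow> 'k) \<Rightarrow> ('p, 'n, 'k) cords set)
      \<Rightarrow> ((nat \<Rightarrow> 'k) \<Rightarrow> ('m, 'n, 'k) cords \<Rightarrow> ('p, 'n, 'k) cords)
      \<Rightarrow> ((nat \<Rightarrow> 'k) \<Rightarrow> ('p, 'n, 'k) cords \<Rightarrow> ('m, 'n, 'k) cords) \<Rightarrow> bool" where
  "right_inverse_family S U V f g \<longleftrightarrow> (\<forall>s\<in>S. \<forall>c\<in>V s. g s c \<in> U \<and> f s (g s c) = c)"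

definition contractive_family ::
    "(nat \<Rightarrow> 'k) set \<Rightarrow> ('m::finite, 'n::finite, 'k::field) cords set
      \<Rightarrow> ((nat \<Rightarrow> 'k) \<Rightarrow> ('m, 'n, 'k) cords \<Rightarrow> ('p::finite, 'n, 'k) cords) \<Rightarrow> bool" where
  "contractive_family S U f \<longleftrightarrow>
     (\<forall>s\<in>S. \<forall>a\<in>U. \<forall>b\<in>U. a \<noteq> b \<longrightarrow> cords_ord (f s a - f s b) > cords_ord (a - b))"

end

theory Submission
  imports Defs "HOL-Computational_Algebra.Polynomial"
begin

text \<open>
  For \<open>s \<in> S\<close> and \<open>c \<in> W\<close> the map \<open>a \<mapsto> \<L>inv s c - \<L>inv s (h s a)\<close> is contractive on \<open>U\<close>; applying \<open>\<L> s\<close> to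
  its fixed point \<open>g s c\<close> gives \<open>f s (g s c) = c\<close>, so that \<open>f s ` U = W\<close>. Each coefficient of \<open>g s c\<close> is a
  coefficient of some iterate of the map at \<open>0\<close>, hence regular as soon as compositions of regular families
  are regular. A composition involves all the coefficients of the inner family, each with its own
  subvariety containing \<open>S\<close>, and infinitely many of these need not contain a common one. But a regular
  function on \<open>Z \<times> Y\<close>, with \<open>Y\<close> a linear neighbourhood of \<open>0\<close>, depends on finitely many coefficients only:
  this is shown by Noetherian induction on \<open>Z\<close>, by means of Hilbert's basis theorem.
\<close>

section \<open>Hilbert's basis theorem\<close>

text \<open>An example without a common subvariety: let \<open>S\<close> be the plane minus the line
  x = 0, together with the origin, and let \<open>Z_j\<close> be the plane minus the point (0,j). A
  subvariety containing \<open>S\<close> is open and dense in the plane, so it misses only finitely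
  many points of that line and lies in only finitely many of the \<open>Z_j\<close>. Finite
  dependence is not immediate either. The quotients representing a regular function vary from point
  to point, each may bring in new coefficients, and the Zariski topology in infinitely many
  coordinates is not Noetherian, so that no finite cover can be read off. Over an irreducible set of
  parameters one quotient controls all the others; Noetherian induction is therefore applied to the
  parameters alone. Linearity of \<open>Y\<close> enters three times: the line joining two points of
  \<open>Y\<close> stays in it, translation by \<open>b - a\<close> preserves it, and a linear
  projection onto it brings back inner values that leave \<open>Y\<close> when they are extended
  beyond \<open>S\<close>.\<close>

definition subring_set :: "'a::comm_ring_1 set \<Rightarrow> bool" where
  "subring_set R \<longleftrightarrow> 1 \<in> R \<and> - 1 \<in> R \<and> (\<forall>a\<in>R. \<forall>b\<in>R. a + b \<in> R \<and> a * b \<in> R)"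

definition ideal_of :: "'a::comm_ring_1 set \<Rightarrow> 'a set \<Rightarrow> bool" where
  "ideal_of R I \<longleftrightarrow> I \<subseteq> R \<and> 0 \<in> I \<and> (\<forall>a\<in>I. \<forall>b\<in>I. a + b \<in> I) \<and> (\<forall>r\<in>R. \<forall>a\<in>I. r * a \<in> I)"

text \<open>Subrings and ideals are subsets of one ambient ring, so that the coordinates of affine
  space can be adjoined one at a time, by induction on their number, within a single type.\<close>

definition noetherian_set :: "'a::comm_ring_1 set \<Rightarrow> bool" where
  "noetherian_set R \<longleftrightarrow>
     (\<forall>I::nat \<Rightarrow> 'a set. (\<forall>n. ideal_of R (I n)) \<longrightarrow> mono I \<longrightarrow> (\<exists>N. \<forall>n\<ge>N. I n = I N))"

lemma noetherian_setD:
  "noetherian_set R \<Longrightarrow> (\<And>n::nat. ideal_of R (I n)) \<Longrightarrow> mono I \<Longrightarrow> \<exists>N. \<forall>n\<ge>N. I n = I N"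
  unfolding noetherian_set_def by auto

text \<open>The values at \<open>x\<close> of polynomials over \<open>R\<close> of degree less than
  \<open>d\<close>. As \<open>x\<close> may satisfy relations over \<open>R\<close>, an element has
  no well-defined degree, and the filtration takes its place.\<close>

primrec adjoin_deg :: "'a::comm_ring_1 set \<Rightarrow> 'a \<Rightarrow> nat \<Rightarrow> 'a set" where
  "adjoin_deg R x 0 = {0}"
| "adjoin_deg R x (Suc d) = {r * x ^ d + p | r p. r \<in> R \<and> p \<in> adjoin_deg R x d}"

declare adjoin_deg.simps(2) [simp del]

definition adjoin :: "'a::comm_ring_1 set \<Rightarrow> 'a \<Rightarrow> 'a set" where
  "adjoin R x = (\<Union>d. adjoin_deg R x d)"

context
  fixes R :: "'a::comm_ring_1 set"
  assumes R: "subring_set R"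
begin

lemma subring_set_zero: "0 \<in> R"
  using R unfolding subring_set_def by (metis add.right_inverse)

lemma subring_set_closed:
  "a \<in> R \<Longrightarrow> b \<in> R \<Longrightarrow> a + b \<in> R" "a \<in> R \<Longrightarrow> b \<in> R \<Longrightarrow> a * b \<in> R" "1 \<in> R" "- 1 \<in> R"
  using R unfolding subring_set_def by auto

lemma adjoin_deg_SucI:
  "a = r * x ^ d + p \<Longrightarrow> r \<in> R \<Longrightarrow> p \<in> adjoin_deg R x d \<Longrightarrow> a \<in> adjoin_deg R x (Suc d)"
  by (auto simp: adjoin_deg.simps(2))

lemma adjoin_deg_zero: "0 \<in> adjoin_deg R x d"
proof (induction d)
  case (Suc d)
  show ?case by (rule adjoin_deg_SucI[of _ 0 x d 0]) (use Suc subring_set_zero in auto)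
qed simp

lemma adjoin_deg_add: "p \<in> adjoin_deg R x d \<Longrightarrow> p' \<in> adjoin_deg R x d \<Longrightarrow> p + p' \<in> adjoin_deg R x d"
proof (induction d arbitrary: p p')
  case (Suc d)
  then obtain r p1 r' p1' where *: "p = r * x ^ d + p1" "p' = r' * x ^ d + p1'" "r \<in> R" "r' \<in> R"
    "p1 \<in> adjoin_deg R x d" "p1' \<in> adjoin_deg R x d" by (auto simp: adjoin_deg.simps(2))
  have "p + p' = (r + r') * x ^ d + (p1 + p1')" using * by (simp add: algebra_simps)
  then show ?case using * Suc.IH subring_set_closed(1) by (blast intro: adjoin_deg_SucI)
qed simp

lemma adjoin_deg_smult: "c \<in> R \<Longrightarrow> p \<in> adjoin_deg R x d \<Longrightarrow> c * p \<in> adjoin_deg R x d"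
proof (induction d arbitrary: p)
  case (Suc d)
  then obtain r p1 where *: "p = r * x ^ d + p1" "r \<in> R" "p1 \<in> adjoin_deg R x d"
    by (auto simp: adjoin_deg.simps(2))
  have "c * p = (c * r) * x ^ d + c * p1" using * by (simp add: algebra_simps)
  then show ?case using * Suc.IH Suc.prems(1) subring_set_closed(2) by (blast intro: adjoin_deg_SucI)
qed simp

lemma adjoin_deg_shift: "p \<in> adjoin_deg R x d \<Longrightarrow> x * p \<in> adjoin_deg R x (Suc d)"
proof (induction d arbitrary: p)
  case 0
  then show ?case using adjoin_deg_zero[of x "Suc 0"] by simp
next
  case (Suc d)
  then obtain r p1 where *: "p = r * x ^ d + p1" "r \<in> R" "p1 \<in> adjoin_deg R x d"
    by (auto simp: adjoin_deg.simps(2))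
  have "x * p = r * x ^ Suc d + x * p1" using * by (simp add: algebra_simps)
  then show ?case using * Suc.IH[of p1] by (blast intro: adjoin_deg_SucI)
qed

lemma adjoin_deg_Suc: "adjoin_deg R x d \<subseteq> adjoin_deg R x (Suc d)"
proof
  fix p assume "p \<in> adjoin_deg R x d"
  moreover have "p = 0 * x ^ d + p" by simp
  ultimately show "p \<in> adjoin_deg R x (Suc d)" using subring_set_zero by (blast intro: adjoin_deg_SucI)
qed

lemma adjoin_deg_mono: "d \<le> e \<Longrightarrow> adjoin_deg R x d \<subseteq> adjoin_deg R x e"
  using lift_Suc_mono_le[of "adjoin_deg R x"] adjoin_deg_Suc by blast

lemma adjoin_add: assumes "p \<in> adjoin R x" "p' \<in> adjoin R x" shows "p + p' \<in> adjoin R x"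
proof -
  obtain d e where "p \<in> adjoin_deg R x d" "p' \<in> adjoin_deg R x e" using assms unfolding adjoin_def by auto
  then have "p \<in> adjoin_deg R x (max d e)" "p' \<in> adjoin_deg R x (max d e)"
    using adjoin_deg_mono[of d "max d e"] adjoin_deg_mono[of e "max d e"] by (meson max.cobounded1 max.cobounded2 subsetD)+
  then show ?thesis using adjoin_deg_add unfolding adjoin_def by blast
qed

lemma adjoin_smult: "c \<in> R \<Longrightarrow> p \<in> adjoin R x \<Longrightarrow> c * p \<in> adjoin R x"
  unfolding adjoin_def by (blast intro: adjoin_deg_smult)

lemma adjoin_power_mult: "p \<in> adjoin R x \<Longrightarrow> x ^ n * p \<in> adjoin R x"
proof (induction n)
  case (Suc n)
  then obtain d where "x ^ n * p \<in> adjoin_deg R x d" unfolding adjoin_def by auto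
  then have "x ^ Suc n * p \<in> adjoin_deg R x (Suc d)"
    using adjoin_deg_shift by (simp add: mult.assoc)
  then show ?case unfolding adjoin_def by blast
qed simp

lemma adjoin_mult: assumes "p \<in> adjoin R x" "p' \<in> adjoin R x" shows "p * p' \<in> adjoin R x"
proof -
  have "p * p' \<in> adjoin R x" if "p \<in> adjoin_deg R x d" for p d
    using that
  proof (induction d arbitrary: p)
    case 0
    then show ?case using adjoin_deg_zero unfolding adjoin_def by auto
  next
    case (Suc d)
    then obtain r p1 where *: "p = r * x ^ d + p1" "r \<in> R" "p1 \<in> adjoin_deg R x d"
      by (auto simp: adjoin_deg.simps(2))
    have "r * (x ^ d * p') \<in> adjoin R x"
      by (intro adjoin_smult *(2) adjoin_power_mult assms(2))
    then show ?case using adjoin_add Suc.IH[OF *(3)] *(1) by (simp add: distrib_right mult.assoc)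
  qed
  then show ?thesis using assms(1) unfolding adjoin_def by blast
qed

lemma subset_adjoin: "R \<subseteq> adjoin R x"
proof
  fix r assume "r \<in> R"
  then have "r \<in> adjoin_deg R x (Suc 0)" by (intro adjoin_deg_SucI[of r r x 0 0]) auto
  then show "r \<in> adjoin R x" unfolding adjoin_def by blast
qed

lemma gen_in_adjoin: "x \<in> adjoin R x"
  using adjoin_power_mult[of 1 x 1] subset_adjoin subring_set_closed(3) by auto

lemma adjoin_subset:
  assumes A: "subring_set A" and "R \<subseteq> A" "x \<in> A"
  shows "adjoin R x \<subseteq> A"
proof -
  have A_closed: "a + b \<in> A" "a * b \<in> A" "1 \<in> A" "0 \<in> A" if "a \<in> A" "b \<in> A" for a b
    using A that unfolding subring_set_def by (auto, metis add.right_inverse)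
  have pw: "x ^ d \<in> A" for d
    by (induction d) (use A_closed assms(3) in auto)
  have "adjoin_deg R x d \<subseteq> A" for d
    by (induction d) (use assms A_closed pw in \<open>auto simp: adjoin_deg.simps(2) subset_iff\<close>)
  then show ?thesis unfolding adjoin_def by blast
qed

text \<open>An element of \<open>I\<close> may have several expressions and hence several leading
  coefficients; all of them count. The value \<open>r = 0\<close> is allowed, which makes this an
  ideal.\<close>

definition lead_coeffs :: "'a \<Rightarrow> nat \<Rightarrow> 'a set \<Rightarrow> 'a set" where
  "lead_coeffs x d I = {r \<in> R. \<exists>p \<in> adjoin_deg R x d. r * x ^ d + p \<in> I}"

lemma lead_coeffs_ideal:
  assumes "ideal_of (adjoin R x) I"
  shows "ideal_of R (lead_coeffs x d I)"
  unfolding ideal_of_def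
proof (intro conjI ballI)
  show "lead_coeffs x d I \<subseteq> R" unfolding lead_coeffs_def by auto
  have "0 * x ^ d + 0 \<in> I" using assms unfolding ideal_of_def by simp
  then show "0 \<in> lead_coeffs x d I"
    unfolding lead_coeffs_def using subring_set_zero adjoin_deg_zero by blast
next
  fix a b assume "a \<in> lead_coeffs x d I" "b \<in> lead_coeffs x d I"
  then obtain p p' where *: "a \<in> R" "b \<in> R" "p \<in> adjoin_deg R x d" "p' \<in> adjoin_deg R x d"
    "a * x ^ d + p \<in> I" "b * x ^ d + p' \<in> I" unfolding lead_coeffs_def by auto
  then have "(a * x ^ d + p) + (b * x ^ d + p') \<in> I" using assms unfolding ideal_of_def by blast
  then have "(a + b) * x ^ d + (p + p') \<in> I" by (simp add: algebra_simps)
  then show "a + b \<in> lead_coeffs x d I"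
    unfolding lead_coeffs_def using * adjoin_deg_add subring_set_closed by blast
next
  fix r a assume r: "r \<in> R" and "a \<in> lead_coeffs x d I"
  then obtain p where *: "a \<in> R" "p \<in> adjoin_deg R x d" "a * x ^ d + p \<in> I"
    unfolding lead_coeffs_def by auto
  then have "r * (a * x ^ d + p) \<in> I" using assms r subset_adjoin unfolding ideal_of_def by blast
  then have "(r * a) * x ^ d + r * p \<in> I" by (simp add: algebra_simps)
  then show "r * a \<in> lead_coeffs x d I"
    unfolding lead_coeffs_def using * r adjoin_deg_smult subring_set_closed by blast
qed

text \<open>Multiplication by \<open>x\<close> stays in \<open>I\<close> and raises the degree
  without changing the leading coefficient.\<close>

lemma lead_coeffs_mono:
  assumes "ideal_of (adjoin R x) I" "I \<subseteq> J" "d \<le> e"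
  shows "lead_coeffs x d I \<subseteq> lead_coeffs x e J"
proof -
  have "lead_coeffs x d I \<subseteq> lead_coeffs x (Suc d) I" for d
  proof
    fix a assume "a \<in> lead_coeffs x d I"
    then obtain p where *: "a \<in> R" "p \<in> adjoin_deg R x d" "a * x ^ d + p \<in> I"
      unfolding lead_coeffs_def by auto
    then have "x * (a * x ^ d + p) \<in> I" using assms gen_in_adjoin unfolding ideal_of_def by blast
    then have "a * x ^ Suc d + x * p \<in> I" by (simp add: algebra_simps)
    then show "a \<in> lead_coeffs x (Suc d) I"
      unfolding lead_coeffs_def using * adjoin_deg_shift by blast
  qed
  then have "lead_coeffs x d I \<subseteq> lead_coeffs x e I"
    using lift_Suc_mono_le[of "\<lambda>d. lead_coeffs x d I"] assms(3) by blast
  also have "\<dots> \<subseteq> lead_coeffs x e J" unfolding lead_coeffs_def using assms(2) by blast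
  finally show ?thesis .
qed

text \<open>Induction on the degree bound: from an element of \<open>J\<close> subtract an element
  of \<open>I\<close> with the same leading coefficient; the difference is in \<open>J\<close> and
  has a smaller bound.\<close>

lemma ideal_eq_if_lead_coeffs_eq:
  assumes I: "ideal_of (adjoin R x) I" and J: "ideal_of (adjoin R x) J" and "I \<subseteq> J"
    and eq: "\<And>d. lead_coeffs x d J \<subseteq> lead_coeffs x d I"
  shows "I = J"
proof -
  have "a \<in> I" if "a \<in> J" "a \<in> adjoin_deg R x d" for a d
    using that
  proof (induction d arbitrary: a)
    case 0
    then show ?case using I unfolding ideal_of_def by simp
  next
    case (Suc d)
    then obtain r p where *: "a = r * x ^ d + p" "r \<in> R" "p \<in> adjoin_deg R x d"
      by (auto simp: adjoin_deg.simps(2))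
    then have "r \<in> lead_coeffs x d I" using Suc.prems(1) eq unfolding lead_coeffs_def by blast
    then obtain p' where p': "p' \<in> adjoin_deg R x d" "r * x ^ d + p' \<in> I"
      unfolding lead_coeffs_def by blast
    have "(- 1) * p' \<in> adjoin_deg R x d" using p' adjoin_deg_smult subring_set_closed(4) by blast
    then have "p + (- 1) * p' \<in> adjoin_deg R x d" using *(3) adjoin_deg_add by blast
    moreover have "a + (- 1) * (r * x ^ d + p') \<in> J"
    proof -
      have "- 1 \<in> adjoin R x" using subset_adjoin subring_set_closed(4) by blast
      then show ?thesis using J p'(2) Suc.prems(1) \<open>I \<subseteq> J\<close> unfolding ideal_of_def by blast
    qed
    then have "p + (- 1) * p' \<in> J" by (simp add: *(1))
    ultimately have "p + (- 1) * p' \<in> I" using Suc.IH by blast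
    then have "(p + (- 1) * p') + (r * x ^ d + p') \<in> I" using I p'(2) unfolding ideal_of_def by blast
    then show ?case by (simp add: *(1) add.commute)
  qed
  moreover have "J \<subseteq> adjoin R x" using J unfolding ideal_of_def by blast
  ultimately show ?thesis using \<open>I \<subseteq> J\<close> unfolding adjoin_def by blast
qed

text \<open>The ideals \<open>?L d n\<close> increase in both indices. Stability of the diagonal
  from \<open>N0\<close> on settles all degrees \<open>d\<close> with \<open>d \<ge> N0\<close> at
  once, since \<open>?L d n\<close> is squeezed between \<open>?L N0 N0\<close> and a later diagonal
  term. Only the finitely many degrees below \<open>N0\<close> remain, and each stabilises
  separately; \<open>K\<close> is beyond all these thresholds.\<close>

theorem hilbert_basis:
  assumes N: "noetherian_set R"
  shows "noetherian_set (adjoin R x)"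
  unfolding noetherian_set_def
proof (intro allI impI)
  fix I :: "nat \<Rightarrow> 'a set"
  assume I: "\<forall>n. ideal_of (adjoin R x) (I n)" and mI: "mono I"
  let ?L = "\<lambda>d n. lead_coeffs x d (I n)"
  have mono2: "?L d n \<subseteq> ?L e m" if "d \<le> e" "n \<le> m" for d e n m
    using lead_coeffs_mono[of x "I n" "I m" d e] I mI that by (auto simp: mono_def)
  have stab: "\<exists>N. \<forall>n\<ge>N. K n = K N" if "\<And>n. ideal_of R (K n)" "mono K" for K :: "nat \<Rightarrow> 'a set"
    using N that unfolding noetherian_set_def by blast
  have "\<exists>N. \<forall>n\<ge>N. ?L n n = ?L N N"
    by (rule stab) (use I lead_coeffs_ideal mono2 in \<open>auto simp: mono_def\<close>)
  then obtain N0 where N0: "\<And>n. n \<ge> N0 \<Longrightarrow> ?L n n = ?L N0 N0" by blast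
  have "\<forall>d. \<exists>N. \<forall>n\<ge>N. ?L d n = ?L d N"
    by (intro allI stab) (use I lead_coeffs_ideal mono2 in \<open>auto simp: mono_def\<close>)
  then obtain M where M: "\<And>d n. n \<ge> M d \<Longrightarrow> ?L d n = ?L d (M d)" by metis
  define K where "K = Max (insert N0 (M ` {..<N0}))"
  have K: "N0 \<le> K" "\<And>d. d < N0 \<Longrightarrow> M d \<le> K" unfolding K_def by auto
  have "?L d n \<subseteq> ?L d K" if "n \<ge> K" for d n
  proof (cases "d < N0")
    case True
    have "?L d n = ?L d (M d)" "?L d K = ?L d (M d)"
      by (rule M; use True K(2)[of d] that in simp)+
    then show ?thesis by blast
  next
    case False
    have "?L d n \<subseteq> ?L (max d n) (max d n)" using mono2 by simp
    also have "\<dots> = ?L N0 N0" by (rule N0) (use False in simp)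
    also have "\<dots> \<subseteq> ?L d K" using mono2 False K(1) by simp
    finally show ?thesis .
  qed
  then have "I K = I n" if "n \<ge> K" for n
    using ideal_eq_if_lead_coeffs_eq[of x "I K" "I n"] I mI that by (auto simp: mono_def)
  then show "\<exists>N. \<forall>n\<ge>N. I n = I N" by metis
qed

end

section \<open>Noetherian induction on subsets of affine space\<close>

text \<open>The polynomial ring in the first \<open>q\<close> coordinates, realised by functions on
  all sequences. On \<open>affine_space q\<close> every polynomial function agrees with its
  truncation.\<close>

definition trunc_funs :: "nat \<Rightarrow> ((nat \<Rightarrow> 'k::field) \<Rightarrow> 'k) set" where
  "trunc_funs q = {\<lambda>s. p (\<lambda>i. if i < q then s i else 0) | p. p \<in> poly_funs}"

lemma trunc_funsI: "p \<in> poly_funs \<Longrightarrow> (\<lambda>s. p (\<lambda>i. if i < q then s i else 0)) \<in> trunc_funs q"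
  unfolding trunc_funs_def by blast

lemma const_trunc_funs: "(\<lambda>_. r) \<in> trunc_funs q"
  by (rule trunc_funsI[OF poly_funs.const])

lemma subring_trunc_funs: "subring_set (trunc_funs q :: ((nat \<Rightarrow> 'k::field) \<Rightarrow> 'k) set)"
proof -
  have "a + b \<in> trunc_funs q \<and> a * b \<in> trunc_funs q" if ab: "a \<in> trunc_funs q" "b \<in> trunc_funs q"
    for a b :: "(nat \<Rightarrow> 'k) \<Rightarrow> 'k"
  proof -
    obtain p p' where p: "a = (\<lambda>s. p (\<lambda>i. if i < q then s i else 0))" "p \<in> poly_funs"
      "b = (\<lambda>s. p' (\<lambda>i. if i < q then s i else 0))" "p' \<in> poly_funs"
      using ab unfolding trunc_funs_def by blast
    show ?thesis
      using trunc_funsI[OF poly_funs.add[OF p(2,4)], of q]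
        trunc_funsI[OF poly_funs.mult[OF p(2,4)], of q]
      unfolding p(1,3) plus_fun_def times_fun_def by simp
  qed
  moreover have "(1 :: (nat \<Rightarrow> 'k) \<Rightarrow> 'k) = (\<lambda>_. 1)" "(- 1 :: (nat \<Rightarrow> 'k) \<Rightarrow> 'k) = (\<lambda>_. - 1)"
    by (auto simp: fun_eq_iff)
  ultimately show ?thesis unfolding subring_set_def
    using const_trunc_funs[of "1::'k" q] const_trunc_funs[of "- 1::'k" q] by auto
qed

lemma trunc_funs_Suc:
  "(trunc_funs (Suc q) :: ((nat \<Rightarrow> 'k::field) \<Rightarrow> 'k) set) = adjoin (trunc_funs q) (\<lambda>s. s q)"
    (is "?A = ?B")
proof
  note sub = subring_trunc_funs[of q, where 'k='k]
  show "?A \<subseteq> ?B"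
  proof
    fix a :: "(nat \<Rightarrow> 'k) \<Rightarrow> 'k" assume "a \<in> ?A"
    then obtain p where p: "a = (\<lambda>s. p (\<lambda>i. if i < Suc q then s i else 0))" "p \<in> poly_funs"
      unfolding trunc_funs_def by blast
    from p(2) have "(\<lambda>s. p (\<lambda>i. if i < Suc q then s i else 0)) \<in> ?B"
    proof induction
      case (const r)
      show ?case using subset_adjoin[OF sub] const_trunc_funs by blast
    next
      case (coord v)
      show ?case
      proof (cases "v = q")
        case True
        then show ?thesis using gen_in_adjoin[OF sub, of "\<lambda>s. s q"] by simp
      next
        case False
        have "(\<lambda>s. if v < q then s v else 0) \<in> trunc_funs q"
          by (rule trunc_funsI[OF poly_funs.coord])
        then show ?thesis using subset_adjoin[OF sub, of "\<lambda>s. s q"] False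
          by (auto simp: less_Suc_eq)
      qed
    next
      case (add f g)
      then show ?case using adjoin_add[OF sub add.IH] by (simp add: plus_fun_def)
    next
      case (mult f g)
      then show ?case using adjoin_mult[OF sub mult.IH] by (simp add: times_fun_def)
    qed
    then show "a \<in> ?B" using p by simp
  qed
  note sub' = subring_trunc_funs[of "Suc q", where 'k='k]
  have q: "(\<lambda>s. s q) \<in> ?A"
    using trunc_funsI[OF poly_funs.coord[of q], of "Suc q"] by simp
  have R: "trunc_funs q \<subseteq> ?A"
  proof
    fix a :: "(nat \<Rightarrow> 'k) \<Rightarrow> 'k" assume "a \<in> trunc_funs q"
    then obtain p where p: "a = (\<lambda>s. p (\<lambda>i. if i < q then s i else 0))" "p \<in> poly_funs"
      unfolding trunc_funs_def by blast
    have pf: "(\<lambda>x. p (\<lambda>i. if i < q then x i else 0)) \<in> poly_funs"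
      using p(2)
    proof induction
      case (coord v)
      then show ?case by (cases "v < q") (auto intro: poly_funs.intros)
    qed (auto intro: poly_funs.intros)
    have eq: "a = (\<lambda>s. (\<lambda>x. p (\<lambda>i. if i < q then x i else 0)) (\<lambda>i. if i < Suc q then s i else 0))"
      unfolding p(1) by (intro ext arg_cong[of _ _ p]) auto
    show "a \<in> ?A" unfolding eq by (rule trunc_funsI[OF pf])
  qed
  show "?B \<subseteq> ?A" by (rule adjoin_subset[OF sub sub' R q])
qed

lemma noetherian_trunc_funs: "noetherian_set (trunc_funs q :: ((nat \<Rightarrow> 'k::field) \<Rightarrow> 'k) set)"
proof (induction q)
  case 0
  have const: "\<exists>r. a = (\<lambda>_. r)" if "a \<in> trunc_funs 0" for a :: "(nat \<Rightarrow> 'k) \<Rightarrow> 'k"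
    using that unfolding trunc_funs_def by auto
  \<comment> \<open>For \<open>q = 0\<close> the functions are constant and form a copy of the
    field, so a nonzero ideal contains a unit.\<close>
  have unit: "J = trunc_funs 0" if J: "ideal_of (trunc_funs 0) J" "J \<noteq> {0}"
    for J :: "((nat \<Rightarrow> 'k) \<Rightarrow> 'k) set"
  proof -
    obtain a where a: "a \<in> J" "a \<noteq> 0" "a \<in> trunc_funs 0" using J unfolding ideal_of_def by blast
    obtain r where r: "a = (\<lambda>_. r)" using const a(3) by blast
    then have "r \<noteq> 0" using a(2) by (auto simp: fun_eq_iff)
    have "b \<in> J" if b: "b \<in> trunc_funs 0" for b
    proof -
      obtain r' where r': "b = (\<lambda>_. r')" using const b by blast
      have "(\<lambda>_. r' / r) * a \<in> J" using J a const_trunc_funs unfolding ideal_of_def by blast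
      moreover have "(\<lambda>_. r' / r) * a = b" using r r' \<open>r \<noteq> 0\<close> by (auto simp: fun_eq_iff)
      ultimately show ?thesis by simp
    qed
    then show ?thesis using J unfolding ideal_of_def by blast
  qed
  show ?case unfolding noetherian_set_def
  proof (intro allI impI)
    fix I :: "nat \<Rightarrow> ((nat \<Rightarrow> 'k) \<Rightarrow> 'k) set"
    assume I: "\<forall>n. ideal_of (trunc_funs 0) (I n)" and "mono I"
    show "\<exists>N. \<forall>n\<ge>N. I n = I N"
    proof (cases "\<exists>N. I N \<noteq> {0}")
      case True
      then obtain N where N: "I N \<noteq> {0}" by blast
      have "I n = trunc_funs 0" if "n \<ge> N" for n
      proof (rule unit)
        have "I N \<subseteq> I n" using \<open>mono I\<close> that by (simp add: mono_def)
        then show "I n \<noteq> {0}" using N I unfolding ideal_of_def by blast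
      qed (use I in blast)
      then show ?thesis by (metis order_refl)
    qed auto
  qed
next
  case (Suc q)
  then show ?case unfolding trunc_funs_Suc by (rule hilbert_basis[OF subring_trunc_funs])
qed

text \<open>The vanishing ideal of \<open>X\<close> is prime or the unit ideal: \<open>X\<close> is
  irreducible or empty.\<close>

definition integral_set :: "('v \<Rightarrow> 'k::field) set \<Rightarrow> bool" where
  "integral_set X \<longleftrightarrow> (\<forall>p\<in>poly_funs. \<forall>p'\<in>poly_funs.
     (\<forall>x\<in>X. p x * p' x = 0) \<longrightarrow> (\<forall>x\<in>X. p x = 0) \<or> (\<forall>x\<in>X. p' x = 0))"

lemma affine_space_induct:
  assumes X: "X \<subseteq> affine_space q"
    and int: "\<And>X. X \<subseteq> affine_space q \<Longrightarrow> integral_set X \<Longrightarrow> Q X"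
    and Un: "\<And>X Y. Q X \<Longrightarrow> Q Y \<Longrightarrow> Q (X \<union> Y)"
  shows "Q (X :: (nat \<Rightarrow> 'k::field) set)"
proof (rule ccontr)
  define I :: "(nat \<Rightarrow> 'k) set \<Rightarrow> ((nat \<Rightarrow> 'k) \<Rightarrow> 'k) set"
    where "I X = {p \<in> trunc_funs q. \<forall>s\<in>X. p s = 0}" for X
  have I: "ideal_of (trunc_funs q) (I X)" for X
    using subring_set_zero[OF subring_trunc_funs] subring_set_closed[OF subring_trunc_funs]
    unfolding ideal_of_def I_def by auto
  define Bad where "Bad X \<longleftrightarrow> X \<subseteq> affine_space q \<and> \<not> Q X" for X :: "(nat \<Rightarrow> 'k) set"
  have step: "\<exists>Y. Bad Y \<and> I X \<subset> I Y" if "Bad X" for X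
  proof -
    have sub: "X \<subseteq> affine_space q" and nQ: "\<not> Q X" using that unfolding Bad_def by auto
    then have "\<not> integral_set X" using int by blast
    then obtain p p' where p: "p \<in> poly_funs" "p' \<in> poly_funs" "\<forall>x\<in>X. p x * p' x = 0"
      "\<not> (\<forall>x\<in>X. p x = 0)" "\<not> (\<forall>x\<in>X. p' x = 0)" unfolding integral_set_def by blast
    have "{x\<in>X. p x = 0} \<union> {x\<in>X. p' x = 0} = X" using p(3) by auto
    then have "\<not> Q {x\<in>X. p x = 0} \<or> \<not> Q {x\<in>X. p' x = 0}"
      using nQ Un[of "{x\<in>X. p x = 0}" "{x\<in>X. p' x = 0}"] by argo
    then obtain r where r: "r \<in> poly_funs" "\<not> (\<forall>x\<in>X. r x = 0)" "\<not> Q {x\<in>X. r x = 0}"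
      using p by blast
    \<comment> \<open>\<open>r\<close> may involve coordinates beyond the first \<open>q\<close>;
      its truncation belongs to the Noetherian ring and has the same values on
      \<open>X\<close>.\<close>
    define r' where "r' = (\<lambda>s. r (\<lambda>i. if i < q then s i else 0))"
    have r'_eq: "r' s = r s" if "s \<in> X" for s
    proof -
      have "(\<lambda>i. if i < q then s i else 0) = s" using sub that unfolding affine_space_def by fastforce
      then show ?thesis unfolding r'_def by simp
    qed
    have "r' \<in> trunc_funs q" unfolding r'_def by (rule trunc_funsI[OF r(1)])
    then have "r' \<in> I {x\<in>X. r x = 0}" "r' \<notin> I X" unfolding I_def using r r'_eq by auto
    moreover have "I X \<subseteq> I {x\<in>X. r x = 0}" unfolding I_def by auto
    ultimately have "I X \<subset> I {x\<in>X. r x = 0}" by (metis psubsetI)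
    moreover have "Bad {x\<in>X. r x = 0}" using r(3) sub unfolding Bad_def by auto
    ultimately show ?thesis by blast
  qed
  assume "\<not> Q X"
  then have "Bad X" using X unfolding Bad_def by simp
  then have "\<exists>F. \<forall>n::nat. Bad (F n) \<and> I (F n) \<subset> I (F (Suc n))"
    by (intro dependent_nat_choice) (use step in blast)+
  then obtain F where F: "\<And>n::nat. Bad (F n)" "\<And>n. I (F n) \<subset> I (F (Suc n))" by blast
  have "mono (\<lambda>n. I (F n))" using F(2) by (intro incseq_SucI) blast
  with I have "\<exists>N. \<forall>n\<ge>N. I (F n) = I (F N)"
    by (rule noetherian_setD[OF noetherian_trunc_funs])
  then obtain N where N: "\<forall>n\<ge>N. I (F n) = I (F N)" by (elim exE)
  have "I (F (Suc N)) = I (F N)" by (rule N[rule_format]) simp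
  then show False using F(2)[of N] by simp
qed

section \<open>Polynomial functions: substitution, finite support, restriction to lines\<close>

lemma poly_funs_diff:
  assumes "f \<in> poly_funs" "g \<in> poly_funs"
  shows "(\<lambda>x. f x - g x) \<in> poly_funs"
proof -
  have "(\<lambda>x. f x + (- 1) * g x) \<in> poly_funs"
    by (intro poly_funs.add poly_funs.mult poly_funs.const assms)
  then show ?thesis by simp
qed

lemma poly_funs_subst:
  assumes "p \<in> poly_funs" "\<And>v. (\<lambda>x. \<sigma> x v) \<in> poly_funs"
  shows "(\<lambda>x. p (\<sigma> x)) \<in> poly_funs"
  using assms(1) by induction (auto intro: poly_funs.intros assms(2))

lemma poly_funs_finite_support:
  assumes "p \<in> poly_funs"
  shows "\<exists>N. finite N \<and> (\<forall>x y. (\<forall>v\<in>N. x v = y v) \<longrightarrow> p x = p y)"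
  using assms
proof induction
  case (const r)
  show ?case by (intro exI[of _ "{}"]) simp
next
  case (coord v)
  show ?case by (intro exI[of _ "{v}"]) simp
next
  case (add f g)
  then obtain M N where "finite M" "\<forall>x y. (\<forall>v\<in>M. x v = y v) \<longrightarrow> f x = f y"
    "finite N" "\<forall>x y. (\<forall>v\<in>N. x v = y v) \<longrightarrow> g x = g y" by (elim exE conjE)
  then show ?case by (intro exI[of _ "M \<union> N"]) (metis UnCI finite_UnI)
next
  case (mult f g)
  then obtain M N where "finite M" "\<forall>x y. (\<forall>v\<in>M. x v = y v) \<longrightarrow> f x = f y"
    "finite N" "\<forall>x y. (\<forall>v\<in>N. x v = y v) \<longrightarrow> g x = g y" by (elim exE conjE)
  then show ?case by (intro exI[of _ "M \<union> N"]) (metis UnCI finite_UnI)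
qed

lemma poly_funs_line:
  assumes "p \<in> poly_funs"
  shows "\<exists>u. \<forall>t. p (\<lambda>v. x v + t * d v) = poly u t"
  using assms
proof induction
  case (const r)
  show ?case by (intro exI[of _ "[:r:]"]) simp
next
  case (coord v)
  show ?case by (intro exI[of _ "[:x v, d v:]"]) simp
next
  case (add f g)
  then show ?case by (metis poly_add)
next
  case (mult f g)
  then show ?case by (metis poly_mult)
qed

section \<open>Regular functions depend on finitely many coefficients\<close>

text \<open>The neighbourhood can be absorbed into the denominator: multiply \<open>P\<close> and
  \<open>Q\<close> by a polynomial function that is nonzero at \<open>x\<close> and vanishes on
  \<open>X\<close> outside \<open>G\<close>.\<close>

lemma zariski_regular_iff:
  "zariski_regular X \<phi> \<longleftrightarrow>
     (\<forall>x\<in>X. \<exists>P\<in>poly_funs. \<exists>Q\<in>poly_funs. Q x \<noteq> 0 \<and> (\<forall>y\<in>X. Q y \<noteq> 0 \<longrightarrow> \<phi> y = P y / Q y))"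
  (is "_ = ?R")
proof
  assume reg: "zariski_regular X \<phi>"
  show ?R
  proof
    fix x assume "x \<in> X"
    with reg obtain G P Q where G: "openin (subtopology zariski X) G" "x \<in> G"
      and PQ: "P \<in> poly_funs" "Q \<in> poly_funs" and eq: "\<And>y. y \<in> G \<Longrightarrow> Q y \<noteq> 0 \<and> \<phi> y = P y / Q y"
      unfolding zariski_regular_def by metis
    from G(1) obtain T where T: "openin zariski T" "G = T \<inter> X"
      unfolding openin_subtopology by (elim exE conjE)
    from T(1) obtain F where F: "F \<subseteq> poly_funs" "T = {x. \<exists>p\<in>F. p x \<noteq> 0}"
      unfolding openin_zariski by (elim exE conjE)
    obtain r where r: "r \<in> F" "r x \<noteq> 0" using G(2) T F by auto
    have rp: "r \<in> poly_funs" using r F by auto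
    have "Q x * r x \<noteq> 0" using eq[OF G(2)] r by simp
    moreover have "\<phi> y = (P y * r y) / (Q y * r y)" if "y \<in> X" "Q y * r y \<noteq> 0" for y
    proof -
      have "y \<in> G" using that r T F by auto
      then show ?thesis using eq that by simp
    qed
    ultimately show "\<exists>P\<in>poly_funs. \<exists>Q\<in>poly_funs. Q x \<noteq> 0 \<and> (\<forall>y\<in>X. Q y \<noteq> 0 \<longrightarrow> \<phi> y = P y / Q y)"
      by (intro bexI[OF _ poly_funs.mult[OF PQ(1) rp]] bexI[OF _ poly_funs.mult[OF PQ(2) rp]]) auto
  qed
next
  assume R: ?R
  show "zariski_regular X \<phi>" unfolding zariski_regular_def
  proof
    fix x assume x: "x \<in> X"
    obtain P Q where PQ: "P \<in> poly_funs" "Q \<in> poly_funs" "Q x \<noteq> 0"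
      "\<forall>y\<in>X. Q y \<noteq> 0 \<longrightarrow> \<phi> y = P y / Q y"
      using bspec[OF R x] by (elim bexE conjE)
    have "openin zariski {x. \<exists>p\<in>{Q}. p x \<noteq> 0}"
      unfolding openin_zariski using PQ(2) by (intro exI[of _ "{Q}"]) simp
    then have "openin (subtopology zariski X) ({x. Q x \<noteq> 0} \<inter> X)"
      unfolding openin_subtopology by (intro exI[of _ "{x. Q x \<noteq> 0}"]) simp
    then show "\<exists>G P Q. openin (subtopology zariski X) G \<and> x \<in> G \<and> P \<in> poly_funs \<and> Q \<in> poly_funs \<and>
        (\<forall>y\<in>G. Q y \<noteq> 0 \<and> \<phi> y = P y / Q y)"
      using PQ x by (intro exI[of _ "{x. Q x \<noteq> 0} \<inter> X"] exI[of _ P] exI[of _ Q]) simp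
  qed
qed

lemma zariski_regularI:
  assumes "\<And>x. x \<in> X \<Longrightarrow>
    \<exists>P Q. P \<in> poly_funs \<and> Q \<in> poly_funs \<and> Q x \<noteq> 0 \<and> (\<forall>y\<in>X. Q y \<noteq> 0 \<longrightarrow> \<phi> y = P y / Q y)"
  shows "zariski_regular X \<phi>"
  unfolding zariski_regular_iff
proof
  fix x assume "x \<in> X"
  from assms[OF this] show "\<exists>P\<in>poly_funs. \<exists>Q\<in>poly_funs.
      Q x \<noteq> 0 \<and> (\<forall>y\<in>X. Q y \<noteq> 0 \<longrightarrow> \<phi> y = P y / Q y)"
    by (elim exE conjE) (intro bexI conjI)
qed

lemma zariski_regularE:
  assumes "zariski_regular X \<phi>" "x \<in> X"
  obtains P Q where "P \<in> poly_funs" "Q \<in> poly_funs" "Q x \<noteq> 0"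
    "\<forall>y\<in>X. Q y \<noteq> 0 \<longrightarrow> \<phi> y = P y / Q y"
proof -
  from bspec[OF assms(1)[unfolded zariski_regular_iff] assms(2)] show ?thesis
    by (elim bexE conjE) (rule that)
qed

section \<open>The algebra of regular functions\<close>

lemma zariski_regular_subset:
  assumes "zariski_regular X \<phi>" "Y \<subseteq> X"
  shows "zariski_regular Y \<phi>"
proof (rule zariski_regularI)
  fix x assume "x \<in> Y"
  then have "x \<in> X" using assms(2) by blast
  then obtain P Q where "P \<in> poly_funs" "Q \<in> poly_funs" "Q x \<noteq> 0"
    "\<forall>y\<in>X. Q y \<noteq> 0 \<longrightarrow> \<phi> y = P y / Q y" by (rule zariski_regularE[OF assms(1)])
  then show "\<exists>P Q. P \<in> poly_funs \<and> Q \<in> poly_funs \<and> Q x \<noteq> 0 \<and>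
      (\<forall>y\<in>Y. Q y \<noteq> 0 \<longrightarrow> \<phi> y = P y / Q y)"
    using assms(2) by (intro exI[of _ P] exI[of _ Q]) auto
qed

lemma zariski_regular_poly_fun: "p \<in> poly_funs \<Longrightarrow> zariski_regular X p"
  by (rule zariski_regularI, rule exI[of _ p], rule exI[of _ "\<lambda>_. 1"]) (simp add: poly_funs.const)

lemma zariski_regular_add:
  assumes "zariski_regular X \<phi>" "zariski_regular X \<psi>"
  shows "zariski_regular X (\<lambda>x. \<phi> x + \<psi> x)"
proof (rule zariski_regularI)
  fix x assume x: "x \<in> X"
  obtain P Q where 1: "P \<in> poly_funs" "Q \<in> poly_funs" "Q x \<noteq> 0"
    "\<forall>y\<in>X. Q y \<noteq> 0 \<longrightarrow> \<phi> y = P y / Q y" by (rule zariski_regularE[OF assms(1) x])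
  obtain P' Q' where 2: "P' \<in> poly_funs" "Q' \<in> poly_funs" "Q' x \<noteq> 0"
    "\<forall>y\<in>X. Q' y \<noteq> 0 \<longrightarrow> \<psi> y = P' y / Q' y" by (rule zariski_regularE[OF assms(2) x])
  show "\<exists>P Q. P \<in> poly_funs \<and> Q \<in> poly_funs \<and> Q x \<noteq> 0 \<and>
      (\<forall>y\<in>X. Q y \<noteq> 0 \<longrightarrow> \<phi> y + \<psi> y = P y / Q y)"
    by (rule exI[of _ "\<lambda>x. P x * Q' x + P' x * Q x"], rule exI[of _ "\<lambda>x. Q x * Q' x"])
      (use 1 2 in \<open>auto intro!: poly_funs.add poly_funs.mult simp: add_frac_eq\<close>)
qed

lemma zariski_regular_mult:
  assumes "zariski_regular X \<phi>" "zariski_regular X \<psi>"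
  shows "zariski_regular X (\<lambda>x. \<phi> x * \<psi> x)"
proof (rule zariski_regularI)
  fix x assume x: "x \<in> X"
  obtain P Q where 1: "P \<in> poly_funs" "Q \<in> poly_funs" "Q x \<noteq> 0"
    "\<forall>y\<in>X. Q y \<noteq> 0 \<longrightarrow> \<phi> y = P y / Q y" by (rule zariski_regularE[OF assms(1) x])
  obtain P' Q' where 2: "P' \<in> poly_funs" "Q' \<in> poly_funs" "Q' x \<noteq> 0"
    "\<forall>y\<in>X. Q' y \<noteq> 0 \<longrightarrow> \<psi> y = P' y / Q' y" by (rule zariski_regularE[OF assms(2) x])
  show "\<exists>P Q. P \<in> poly_funs \<and> Q \<in> poly_funs \<and> Q x \<noteq> 0 \<and>
      (\<forall>y\<in>X. Q y \<noteq> 0 \<longrightarrow> \<phi> y * \<psi> y = P y / Q y)"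
    by (rule exI[of _ "\<lambda>x. P x * P' x"], rule exI[of _ "\<lambda>x. Q x * Q' x"])
      (use 1 2 in \<open>auto intro!: poly_funs.mult\<close>)
qed

lemma zariski_regular_const: "zariski_regular X (\<lambda>_. r)"
  by (rule zariski_regular_poly_fun[OF poly_funs.const])

lemma zariski_regular_diff:
  assumes "zariski_regular X \<phi>" "zariski_regular X \<psi>"
  shows "zariski_regular X (\<lambda>x. \<phi> x - \<psi> x)"
  using zariski_regular_add[OF assms(1) zariski_regular_mult[OF zariski_regular_const[of X "- 1"] assms(2)]]
  by simp

lemma zariski_regular_sum:
  "(\<And>j. j \<in> A \<Longrightarrow> zariski_regular X (\<phi> j)) \<Longrightarrow> zariski_regular X (\<lambda>x. \<Sum>j\<in>A. \<phi> j x)"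
  by (induction A rule: infinite_finite_induct)
    (auto intro: zariski_regular_const zariski_regular_add)

lemma zariski_regular_poly_comp:
  assumes "p \<in> poly_funs" "\<And>v. zariski_regular X (\<lambda>x. \<sigma> x v)"
  shows "zariski_regular X (\<lambda>x. p (\<sigma> x))"
  using assms(1)
  by induction (auto intro: assms(2) zariski_regular_const zariski_regular_add zariski_regular_mult)

text \<open>The map \<open>\<sigma>\<close> may have infinitely many coordinates, but a local
  quotient for \<open>\<phi>\<close> consists of two polynomials, and each of them involves finitely
  many.\<close>

lemma zariski_regular_comp:
  assumes \<phi>: "zariski_regular Y \<phi>" and \<sigma>: "\<sigma> ` X \<subseteq> Y" "\<And>v. zariski_regular X (\<lambda>x. \<sigma> x v)"
  shows "zariski_regular X (\<lambda>x. \<phi> (\<sigma> x))"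
proof (rule zariski_regularI)
  fix x assume x: "x \<in> X"
  then have "\<sigma> x \<in> Y" using \<sigma>(1) by auto
  then obtain p q where pq: "p \<in> poly_funs" "q \<in> poly_funs" "q (\<sigma> x) \<noteq> 0"
    "\<forall>y\<in>Y. q y \<noteq> 0 \<longrightarrow> \<phi> y = p y / q y" by (rule zariski_regularE[OF \<phi>])
  obtain A B where 1: "A \<in> poly_funs" "B \<in> poly_funs" "B x \<noteq> 0"
    "\<forall>y\<in>X. B y \<noteq> 0 \<longrightarrow> p (\<sigma> y) = A y / B y"
    by (rule zariski_regularE[OF zariski_regular_poly_comp[OF pq(1) \<sigma>(2)] x])
  obtain C D where 2: "C \<in> poly_funs" "D \<in> poly_funs" "D x \<noteq> 0"
    "\<forall>y\<in>X. D y \<noteq> 0 \<longrightarrow> q (\<sigma> y) = C y / D y"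
    by (rule zariski_regularE[OF zariski_regular_poly_comp[OF pq(2) \<sigma>(2)] x])
  have "C x \<noteq> 0" using 2(3) 2(4)[rule_format, OF x] pq(3) by auto
  then have "B x * C x * D x \<noteq> 0" using 1 2 by simp
  \<comment> \<open>This is (A/B) / (C/D), extended by \<open>D\<close> so that a nonzero
    denominator forces \<open>D y\<close> to be nonzero too.\<close>
  moreover have "\<phi> (\<sigma> y) = (A y * D y * D y) / (B y * C y * D y)"
    if "y \<in> X" "B y * C y * D y \<noteq> 0" for y
  proof -
    have "q (\<sigma> y) \<noteq> 0" "p (\<sigma> y) = A y / B y" "q (\<sigma> y) = C y / D y" "\<sigma> y \<in> Y"
      using that 1(4) 2(4) \<sigma>(1) by auto
    then show ?thesis using pq(4)[rule_format, of "\<sigma> y"] that by simp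
  qed
  ultimately show "\<exists>P Q. P \<in> poly_funs \<and> Q \<in> poly_funs \<and> Q x \<noteq> 0 \<and>
      (\<forall>y\<in>X. Q y \<noteq> 0 \<longrightarrow> \<phi> (\<sigma> y) = P y / Q y)"
    by (intro exI[of _ "\<lambda>y. A y * D y * D y"] exI[of _ "\<lambda>y. B y * C y * D y"] conjI poly_funs.mult
      1(1,2) 2(1,2)) auto
qed

section \<open>Irreducibility and finite dependence\<close>

lemma coords_simps [simp]: "coords (s, a) (Inl j) = s j" "coords (s, a) (Inr (i, \<alpha>)) = a i \<alpha>"
  unfolding coords_def by auto

text \<open>Let \<open>p\<close> be nonzero at \<open>(s1, a1)\<close> and \<open>p'\<close> at
  \<open>(s2, a2)\<close>. Irreducibility of \<open>X\<close>, with \<open>a1\<close> and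
  \<open>a2\<close> frozen, gives one parameter \<open>s\<close> serving both. On the line through
  \<open>a1\<close> and \<open>a2\<close> both functions are then nonzero polynomials in one
  variable, and as the field is infinite they are both nonzero at some point of it.\<close>

lemma integral_set_coords:
  fixes Y :: "('m, 'n, 'k::field_char_0) cords set"
  assumes X: "integral_set X" and Y: "cords.subspace Y"
  shows "integral_set (coords ` (X \<times> Y))"
  unfolding integral_set_def
proof (intro ballI impI)
  fix p p' :: "(nat + 'm \<times> ('n \<Rightarrow> nat) \<Rightarrow> 'k) \<Rightarrow> 'k"
  assume p: "p \<in> poly_funs" "p' \<in> poly_funs" and pp': "\<forall>x\<in>coords ` (X \<times> Y). p x * p' x = 0"
  show "(\<forall>x\<in>coords ` (X \<times> Y). p x = 0) \<or> (\<forall>x\<in>coords ` (X \<times> Y). p' x = 0)"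
  proof (rule ccontr)
    assume "\<not> ?thesis"
    then obtain s1 a1 s2 a2 where 1: "s1 \<in> X" "a1 \<in> Y" "p (coords (s1, a1)) \<noteq> 0"
      and 2: "s2 \<in> X" "a2 \<in> Y" "p' (coords (s2, a2)) \<noteq> 0" by auto
    have restr: "(\<lambda>s. r (coords (s, a))) \<in> poly_funs" if "r \<in> poly_funs" for r and a :: "('m, 'n, 'k) cords"
      using that
    proof (rule poly_funs_subst)
      fix v :: "nat + 'm \<times> ('n \<Rightarrow> nat)"
      show "(\<lambda>s. coords (s, a) v) \<in> poly_funs"
        by (cases v) (auto intro: poly_funs.intros simp: coords_def)
    qed
    have "\<not> (\<forall>s\<in>X. p (coords (s, a1)) * p' (coords (s, a2)) = 0)"
      using X[unfolded integral_set_def, rule_format, OF restr[OF p(1), of a1] restr[OF p(2), of a2]] 1 2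
      by blast
    then obtain s where s: "s \<in> X" "p (coords (s, a1)) \<noteq> 0" "p' (coords (s, a2)) \<noteq> 0" by auto
    let ?line = "\<lambda>t. coords (s, a1 + cords_scale t (a2 - a1))"
    have line: "?line t = (\<lambda>v. coords (s, a1) v + t * coords (0, a2 - a1) v)" for t
    proof
      fix v show "?line t v = coords (s, a1) v + t * coords (0, a2 - a1) v"
        by (cases v) (auto simp: coords_def cords_scale_def)
    qed
    obtain u u' where u: "\<And>t. p (?line t) = poly u t" "\<And>t. p' (?line t) = poly u' t"
      using poly_funs_line[OF p(1), of "coords (s, a1)" "coords (0, a2 - a1)"]
        poly_funs_line[OF p(2), of "coords (s, a1)" "coords (0, a2 - a1)"] unfolding line by metis
    have "a1 + cords_scale 0 (a2 - a1) = a1" "a1 + cords_scale 1 (a2 - a1) = a2"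
      by (auto simp: cords_scale_def fun_eq_iff)
    then have "poly u 0 \<noteq> 0" "poly u' 1 \<noteq> 0" using s u(1)[of 0] u(2)[of 1] by simp_all
    then have "u \<noteq> 0" "u' \<noteq> 0" by auto
    then have "finite {t. poly (u * u') t = 0}" by (intro poly_roots_finite) simp
    moreover have "infinite (UNIV :: 'k set)" by (rule infinite_UNIV_char_0)
    ultimately obtain t where t: "poly (u * u') t \<noteq> 0"
      by (metis (mono_tags, lifting) UNIV_eq_I mem_Collect_eq)
    have "a1 + cords_scale t (a2 - a1) \<in> Y"
      using Y 1 2 by (intro cords.subspace_add cords.subspace_scale cords.subspace_diff)
    then have "p (?line t) * p' (?line t) = 0" using pp' s(1) by auto
    then show False using t u by simp
  qed
qed

text \<open>If \<open>\<gamma> = P0 / Q0\<close> near one point, only the coefficients occurring in \<open>P0\<close> and \<open>Q0\<close> matter: by integrality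
  any other local representation \<open>P / Q\<close> satisfies \<open>P0 * Q = P * Q0\<close> everywhere, and \<open>P0\<close>, \<open>Q0\<close> are
  invariant under translation by \<open>b - a\<close>.\<close>

lemma regular_finite_dependence_integral:
  fixes Y :: "('m, 'n, 'k::field_char_0) cords set"
  assumes X: "integral_set X" and Y: "cords.subspace Y"
    and \<gamma>: "zariski_regular (coords ` (X \<times> Y)) \<gamma>"
  shows "\<exists>N. finite N \<and> (\<forall>s\<in>X. \<forall>a\<in>Y. \<forall>b\<in>Y.
    (\<forall>(i, \<alpha>)\<in>N. a i \<alpha> = b i \<alpha>) \<longrightarrow> \<gamma> (coords (s, a)) = \<gamma> (coords (s, b)))"
proof (cases "X = {}")
  case True
  then show ?thesis by auto
next
  case False
  let ?V = "coords ` (X \<times> Y)"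
  have mem: "coords (s, a) \<in> ?V" if "s \<in> X" "a \<in> Y" for s a using that by auto
  \<comment> \<open>By integrality of \<open>?V\<close>, a factor that is nonzero somewhere on
    \<open>?V\<close> can be cancelled.\<close>
  have cancel: "\<forall>x\<in>?V. p x = 0"
    if "p \<in> poly_funs" "r \<in> poly_funs" "y \<in> ?V" "r y \<noteq> 0" "\<And>x. x \<in> ?V \<Longrightarrow> p x * r x = 0" for p r y
    using integral_set_coords[OF X Y] that unfolding integral_set_def by blast
  have "0 \<in> Y" using Y by (rule cords.subspace_0)
  with False obtain s0 where s0: "s0 \<in> X" "coords (s0, 0) \<in> ?V" by auto
  obtain P0 Q0 where 0: "P0 \<in> poly_funs" "Q0 \<in> poly_funs" "Q0 (coords (s0, 0)) \<noteq> 0"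
    "\<forall>y\<in>?V. Q0 y \<noteq> 0 \<longrightarrow> \<gamma> y = P0 y / Q0 y" by (rule zariski_regularE[OF \<gamma> s0(2)])
  have cross: "P0 x * Q x = P x * Q0 x"
    if PQ: "P \<in> poly_funs" "Q \<in> poly_funs" "y \<in> ?V" "Q y \<noteq> 0"
      "\<forall>z\<in>?V. Q z \<noteq> 0 \<longrightarrow> \<gamma> z = P z / Q z" and x: "x \<in> ?V" for P Q y x
  proof -
    \<comment> \<open>The numerator of the difference of two quotients. Times both denominators it
      vanishes on all of \<open>?V\<close>, trivially where a denominator does; then
      \<open>Q0\<close> and \<open>Q\<close> are cancelled in turn.\<close>
    let ?d = "\<lambda>x. P0 x * Q x - P x * Q0 x"
    have d: "?d \<in> poly_funs" by (intro poly_funs_diff poly_funs.mult 0 PQ)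
    have dQ: "(\<lambda>x. ?d x * Q x) \<in> poly_funs" by (intro poly_funs.mult d PQ)
    have "?d z * Q z * Q0 z = 0" if "z \<in> ?V" for z
    proof (cases "Q z = 0 \<or> Q0 z = 0")
      case False
      then have "P z / Q z = P0 z / Q0 z" using 0(4)[rule_format, OF that] PQ(5)[rule_format, OF that] by simp
      then show ?thesis using False by (simp add: frac_eq_eq)
    qed auto
    then have "\<forall>z\<in>?V. ?d z * Q z = 0" by (rule cancel[OF dQ 0(2) s0(2) 0(3)])
    then have "\<forall>z\<in>?V. ?d z = 0" by (intro cancel[OF d PQ(2-4)]) auto
    then show ?thesis using x by auto
  qed
  obtain N1 where N1: "finite N1" "\<forall>x y. (\<forall>v\<in>N1. x v = y v) \<longrightarrow> P0 x = P0 y"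
    using poly_funs_finite_support[OF 0(1)] by auto
  obtain N2 where N2: "finite N2" "\<forall>x y. (\<forall>v\<in>N2. x v = y v) \<longrightarrow> Q0 x = Q0 y"
    using poly_funs_finite_support[OF 0(2)] by auto
  \<comment> \<open>Only cord coordinates are kept, since \<open>a\<close> and \<open>b\<close> are
    compared at the same parameter.\<close>
  define N where "N = Inr -` (N1 \<union> N2)"
  have "finite N" unfolding N_def using N1 N2 by (intro finite_vimageI) auto
  moreover have "\<gamma> (coords (s, a)) = \<gamma> (coords (s, b))"
    if sab: "s \<in> X" "a \<in> Y" "b \<in> Y" "\<forall>(i, \<alpha>)\<in>N. a i \<alpha> = b i \<alpha>" for s a b
  proof -
    let ?d = "b - a"
    let ?t = "\<lambda>x v. x v + coords (0, ?d) v"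
    have t_coords: "?t (coords (s', c)) = coords (s', c + ?d)" for s' :: "nat \<Rightarrow> 'k" and c
    proof
      fix v show "?t (coords (s', c)) v = coords (s', c + ?d) v" by (cases v) (auto simp: coords_def)
    qed
    have tV: "?t x \<in> ?V" if x: "x \<in> ?V" for x
    proof -
      obtain s' c where x: "x = coords (s', c)" "s' \<in> X" "c \<in> Y" using x by auto
      have "c + ?d \<in> Y" using Y x(3) sab(2,3) by (intro cords.subspace_add cords.subspace_diff)
      then show ?thesis unfolding x(1) t_coords using x(2) by (rule mem[rotated])
    qed
    have d0: "coords (0, ?d) v = 0" if "v \<in> N1 \<union> N2" for v
      using that sab(4) by (cases v) (force simp: coords_def N_def)+
    have inv: "P0 (?t x) = P0 x" "Q0 (?t x) = Q0 x" for x
      using N1(2) N2(2) d0 by auto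
    obtain P1 Q1 where 1: "P1 \<in> poly_funs" "Q1 \<in> poly_funs" "Q1 (coords (s, a)) \<noteq> 0"
      "\<forall>y\<in>?V. Q1 y \<noteq> 0 \<longrightarrow> \<gamma> y = P1 y / Q1 y"
      by (rule zariski_regularE[OF \<gamma> mem[OF sab(1,2)]])
    obtain P2 Q2 where 2: "P2 \<in> poly_funs" "Q2 \<in> poly_funs" "Q2 (coords (s, b)) \<noteq> 0"
      "\<forall>y\<in>?V. Q2 y \<noteq> 0 \<longrightarrow> \<gamma> y = P2 y / Q2 y"
      by (rule zariski_regularE[OF \<gamma> mem[OF sab(1,3)]])
    have t_poly: "(\<lambda>x. r (?t x)) \<in> poly_funs" if "r \<in> poly_funs" for r
      using that by (rule poly_funs_subst) (intro poly_funs.add poly_funs.coord poly_funs.const)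
    \<comment> \<open>The numerator of the difference between the quotient chosen at
      \<open>(s, a)\<close> and the translate of the one chosen at \<open>(s, b)\<close>; its
      vanishing at \<open>coords (s, a)\<close> is the claim.\<close>
    let ?e = "\<lambda>x. P1 x * Q2 (?t x) - P2 (?t x) * Q1 x"
    have e: "?e \<in> poly_funs"
      by (intro poly_funs_diff poly_funs.mult 1(1,2) t_poly 2(1,2))
    have "?e x * Q0 x = 0" if x: "x \<in> ?V" for x
    proof -
      have c1: "P0 x * Q1 x = P1 x * Q0 x" by (rule cross[OF 1(1,2) mem[OF sab(1,2)] 1(3,4) x])
      have c2: "P0 x * Q2 (?t x) = P2 (?t x) * Q0 x"
        using cross[OF 2(1,2) mem[OF sab(1,3)] 2(3,4) tV[OF x]] unfolding inv .
      have "?e x * Q0 x = (P1 x * Q0 x) * Q2 (?t x) - (P2 (?t x) * Q0 x) * Q1 x"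
        by (simp only: algebra_simps)
      also have "\<dots> = 0" unfolding c1[symmetric] c2[symmetric] by (simp only: algebra_simps) simp
      finally show ?thesis .
    qed
    then have "\<forall>x\<in>?V. ?e x = 0" by (rule cancel[OF e 0(2) s0(2) 0(3)])
    then have "?e (coords (s, a)) = 0" using mem[OF sab(1,2)] by blast
    moreover have "?t (coords (s, a)) = coords (s, b)" unfolding t_coords by simp
    ultimately have "P1 (coords (s, a)) * Q2 (coords (s, b)) = P2 (coords (s, b)) * Q1 (coords (s, a))"
      by simp
    then show ?thesis
      using 1(4)[rule_format, OF mem[OF sab(1,2)] 1(3)] 2(4)[rule_format, OF mem[OF sab(1,3)] 2(3)] 1(3) 2(3)
      by (simp add: frac_eq_eq)
  qed
  ultimately show ?thesis by blast
qed

lemma regular_finite_dependence: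
  fixes Y :: "('m, 'n, 'k::field_char_0) cords set"
  assumes "X \<subseteq> affine_space q" and Y: "cords.subspace Y"
    and "zariski_regular (coords ` (X \<times> Y)) \<gamma>"
  shows "\<exists>N. finite N \<and> (\<forall>s\<in>X. \<forall>a\<in>Y. \<forall>b\<in>Y.
    (\<forall>(i, \<alpha>)\<in>N. a i \<alpha> = b i \<alpha>) \<longrightarrow> \<gamma> (coords (s, a)) = \<gamma> (coords (s, b)))"
    (is "?dep X")
proof -
  \<comment> \<open>Regularity becomes a premise of the induction predicate, which has to hold for
    every irreducible subset of affine space.\<close>
  have "zariski_regular (coords ` (X \<times> Y)) \<gamma> \<longrightarrow> ?dep X"
    using assms(1)
  proof (rule affine_space_induct)
    fix X :: "(nat \<Rightarrow> 'k) set" assume "integral_set X"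
    then show "zariski_regular (coords ` (X \<times> Y)) \<gamma> \<longrightarrow> ?dep X"
      using regular_finite_dependence_integral[OF _ Y] by blast
  next
    fix X X' :: "(nat \<Rightarrow> 'k) set"
    assume IH: "zariski_regular (coords ` (X \<times> Y)) \<gamma> \<longrightarrow> ?dep X"
      "zariski_regular (coords ` (X' \<times> Y)) \<gamma> \<longrightarrow> ?dep X'"
    show "zariski_regular (coords ` ((X \<union> X') \<times> Y)) \<gamma> \<longrightarrow> ?dep (X \<union> X')"
    proof
      assume reg: "zariski_regular (coords ` ((X \<union> X') \<times> Y)) \<gamma>"
      have "?dep X" "?dep X'"
        using IH zariski_regular_subset[OF reg, of "coords ` (X \<times> Y)"]
          zariski_regular_subset[OF reg, of "coords ` (X' \<times> Y)"] by auto
      then obtain N N' where "finite N" "finite N'"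
        and N: "\<forall>s\<in>X. \<forall>a\<in>Y. \<forall>b\<in>Y. (\<forall>(i, \<alpha>)\<in>N. a i \<alpha> = b i \<alpha>) \<longrightarrow> \<gamma> (coords (s, a)) = \<gamma> (coords (s, b))"
        and N': "\<forall>s\<in>X'. \<forall>a\<in>Y. \<forall>b\<in>Y. (\<forall>(i, \<alpha>)\<in>N'. a i \<alpha> = b i \<alpha>) \<longrightarrow> \<gamma> (coords (s, a)) = \<gamma> (coords (s, b))"
        by (elim exE conjE)
      show "?dep (X \<union> X')"
      proof (intro exI[of _ "N \<union> N'"] conjI ballI impI)
        show "finite (N \<union> N')" using \<open>finite N\<close> \<open>finite N'\<close> by simp
        fix s a b assume "s \<in> X \<union> X'" "a \<in> Y" "b \<in> Y" "\<forall>(i, \<alpha>)\<in>N \<union> N'. a i \<alpha> = b i \<alpha>"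
        then show "\<gamma> (coords (s, a)) = \<gamma> (coords (s, b))"
          using N[rule_format, of s a b] N'[rule_format, of s a b] by blast
      qed
    qed
  qed
  then show ?thesis using assms(3) by blast
qed

section \<open>Orders, the m-adic filtration and linear neighbourhoods of 0\<close>

lemma cord_ord_ge_iff: "enat k \<le> cord_ord c \<longleftrightarrow> (\<forall>\<alpha>. sum \<alpha> UNIV < k \<longrightarrow> c \<alpha> = 0)"
  unfolding cord_ord_def le_INF_iff by (auto simp: not_less[symmetric])

lemma cords_ord_ge_iff: "enat k \<le> cords_ord a \<longleftrightarrow> (\<forall>i \<alpha>. sum \<alpha> UNIV < k \<longrightarrow> a i \<alpha> = 0)"
  unfolding cords_ord_def by (auto simp: cord_ord_ge_iff)

lemma finite_multi_index_less: "finite {\<alpha> :: 'n::finite \<Rightarrow> nat. sum \<alpha> UNIV < k}"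
proof (rule finite_subset)
  show "{\<alpha> :: 'n \<Rightarrow> nat. sum \<alpha> UNIV < k} \<subseteq> PiE UNIV (\<lambda>_. {..<k})"
  proof
    fix \<alpha> :: "'n \<Rightarrow> nat" assume "\<alpha> \<in> {\<alpha>. sum \<alpha> UNIV < k}"
    then have "\<alpha> i < k" for i using member_le_sum[of i UNIV \<alpha>] by auto
    then show "\<alpha> \<in> PiE UNIV (\<lambda>_. {..<k})" by auto
  qed
  show "finite (PiE (UNIV :: 'n set) (\<lambda>_. {..<k}))" by (intro finite_PiE) auto
qed

lemma finite_multi_index_decomp: "finite {(\<alpha>, \<beta>). \<alpha> + \<beta> = (\<gamma> :: 'n::finite \<Rightarrow> nat)}"
proof (rule finite_subset)
  let ?A = "{\<alpha> :: 'n \<Rightarrow> nat. sum \<alpha> UNIV < Suc (sum \<gamma> UNIV)}"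
  show "{(\<alpha>, \<beta>). \<alpha> + \<beta> = \<gamma>} \<subseteq> ?A \<times> ?A" by (auto simp: sum.distrib less_Suc_eq_le)
  show "finite (?A \<times> ?A)" by (intro finite_cartesian_product finite_multi_index_less)
qed

text \<open>In each product either the left factor is the zero constant term, or the index of the
  right factor has degree at least one less than \<open>\<gamma>\<close>.\<close>

lemma max_ideal_times_order:
  assumes M: "\<And>v i \<alpha>. v \<in> M \<Longrightarrow> sum \<alpha> UNIV < k \<Longrightarrow> v i \<alpha> = 0"
    and a: "a \<in> max_ideal_times M" and \<gamma>: "sum \<gamma> UNIV < Suc k"
  shows "a i \<gamma> = 0"
proof -
  obtain N c v where a: "a = (\<Sum>j<N::nat. (\<lambda>i. cord_mult (c j) (v j i)))"
    and cv: "\<And>j. j < N \<Longrightarrow> c j \<in> max_ideal \<and> v j \<in> M"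
    using a unfolding max_ideal_times_def by auto
  have "cord_mult (c j) (v j i) \<gamma> = 0" if "j < N" for j
    unfolding cord_mult_def
  proof (rule sum.neutral, clarify)
    fix \<alpha> \<beta> assume ab: "\<gamma> = \<alpha> + \<beta>"
    show "c j \<alpha> * v j i \<beta> = 0"
    proof (cases "\<alpha> = 0")
      case True
      then show ?thesis using cv[OF that] by (simp add: max_ideal_def)
    next
      case False
      then obtain m where "\<alpha> m \<noteq> 0" by (auto simp: fun_eq_iff)
      then have "sum \<alpha> UNIV \<noteq> 0" by auto
      moreover have "sum \<alpha> UNIV + sum \<beta> UNIV < Suc k" using \<gamma> unfolding ab by (simp add: sum.distrib)
      ultimately have "sum \<beta> UNIV < k" by linarith
      then show ?thesis using M cv[OF that] by simp
    qed
  qed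
  then have "(\<Sum>j<N. cord_mult (c j) (v j i) \<gamma>) = 0" by (intro sum.neutral) auto
  moreover have "(\<Sum>j<N'. (\<lambda>i. cord_mult (c j) (v j i))) i \<gamma> = (\<Sum>j<N'. cord_mult (c j) (v j i) \<gamma>)" for N' :: nat
    by (induction N') auto
  ultimately show ?thesis unfolding a by simp
qed

lemma madic_subset: "a \<in> madic l \<Longrightarrow> sum \<alpha> UNIV < l \<Longrightarrow> a i \<alpha> = 0"
proof (induction l arbitrary: a i \<alpha>)
  case (Suc l)
  have "a \<in> max_ideal_times (madic l)" using Suc.prems(1) unfolding madic_def by simp
  then show ?case
    by (rule max_ideal_times_order[where M = "madic l" and k = l, rotated])
      (use Suc in auto)
qed simp

text \<open>The left factor is the variable with index \<open>j\<close>, so the product shifts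
  exponents by \<open>e j\<close>. Subtraction of naturals truncates, hence the separate value for
  \<open>\<gamma> j = 0\<close>.\<close>

lemma cord_mult_variable:
  fixes c :: "('n::finite, 'k::field) cord"
  defines "e j \<equiv> (\<lambda>i. if i = j then 1 else 0)"
  shows "cord_mult (\<lambda>\<alpha>. if \<alpha> = e j then 1 else 0) c \<gamma> = (if \<gamma> j = 0 then 0 else c (\<gamma> - e j))"
proof -
  let ?D = "{(\<alpha>, \<beta>). \<alpha> + \<beta> = \<gamma>}"
  have "cord_mult (\<lambda>\<alpha>. if \<alpha> = e j then 1 else 0) c \<gamma> = (\<Sum>(\<alpha>, \<beta>)\<in>?D. if \<alpha> = e j then c \<beta> else 0)"
    unfolding cord_mult_def by (intro sum.cong) auto
  also have "\<dots> = (\<Sum>(\<alpha>, \<beta>)\<in>{(\<alpha>, \<beta>)\<in>?D. \<alpha> = e j}. c \<beta>)"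
    by (rule sum.mono_neutral_cong_right[OF finite_multi_index_decomp]) (auto split: if_splits)
  also have "{(\<alpha>, \<beta>)\<in>?D. \<alpha> = e j} = (if \<gamma> j = 0 then {} else {(e j, \<gamma> - e j)})"
  proof (cases "\<gamma> j = 0")
    case True
    have "e j + \<beta> \<noteq> \<gamma>" for \<beta>
    proof
      assume "e j + \<beta> = \<gamma>"
      then have "(e j + \<beta>) j = \<gamma> j" by simp
      then show False using True by (simp add: e_def)
    qed
    then show ?thesis using True by auto
  next
    case False
    then have "e j + (\<gamma> - e j) = \<gamma>" by (auto simp: e_def fun_eq_iff)
    then have mem: "(e j, \<gamma> - e j) \<in> {(\<alpha>, \<beta>)\<in>?D. \<alpha> = e j}" by simp
    have "\<beta> = \<gamma> - e j" if "e j + \<beta> = \<gamma>" for \<beta>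
      unfolding that[symmetric] by (simp add: fun_eq_iff)
    then have "{(\<alpha>, \<beta>)\<in>?D. \<alpha> = e j} \<subseteq> {(e j, \<gamma> - e j)}" by blast
    then have "{(\<alpha>, \<beta>)\<in>?D. \<alpha> = e j} = {(e j, \<gamma> - e j)}"
      by (rule equalityI) (simp only: insert_subset empty_subsetI mem simp_thms)
    then show ?thesis using False by simp
  qed
  finally show ?thesis by simp
qed

text \<open>Each monomial \<open>x\<^sup>\<gamma>\<close> of \<open>a\<close> is assigned to one variable \<open>v \<gamma>\<close> dividing it, and \<open>a\<close> is the sum over
  the variables of the variable times the quotient of its share of \<open>a\<close>.\<close>

lemma madic_Suc_supset:
  fixes a :: "('m, 'n::finite, 'k::field) cords"
  assumes M: "\<And>b :: ('m, 'n, 'k) cords. (\<And>i \<alpha>. sum \<alpha> UNIV < l \<Longrightarrow> b i \<alpha> = 0) \<Longrightarrow> b \<in> M"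
    and a: "\<And>i \<alpha>. sum \<alpha> UNIV < Suc l \<Longrightarrow> a i \<alpha> = 0"
  shows "a \<in> max_ideal_times M"
proof -
  define e :: "'n \<Rightarrow> 'n \<Rightarrow> nat" where "e j = (\<lambda>i. if i = j then 1 else 0)" for j
  define v where "v \<gamma> = (SOME j. \<gamma> j \<noteq> 0)" for \<gamma> :: "'n \<Rightarrow> nat"
  have v: "\<gamma> (v \<gamma>) \<noteq> 0" if "\<gamma> \<noteq> 0" for \<gamma>
  proof -
    have "\<exists>j. \<gamma> j \<noteq> 0" using that by (auto simp: fun_eq_iff)
    then show ?thesis unfolding v_def by (rule someI_ex)
  qed
  define w where "w j = (\<lambda>i \<beta>. if v (\<beta> + e j) = j then a i (\<beta> + e j) else 0)" for j
  \<comment> \<open>The variables are numbered because \<open>max_ideal_times\<close> sums over an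
    initial segment of the naturals.\<close>
  obtain h :: "nat \<Rightarrow> 'n" where h: "bij_betw h {..<card (UNIV :: 'n set)} UNIV"
    using ex_bij_betw_nat_finite[of "UNIV :: 'n set"] by (auto simp: atLeast0LessThan)
  have sum_e: "sum (e j) UNIV = 1" for j by (simp add: e_def)
  have wM: "w j \<in> M" for j
    by (rule M) (auto simp: w_def sum.distrib sum_e intro!: a)
  have xI: "(\<lambda>\<alpha>. if \<alpha> = e j then 1 else 0) \<in> max_ideal" for j
  proof -
    have "0 \<noteq> e j" using sum_e[of j] by auto
    then show ?thesis by (simp add: max_ideal_def)
  qed
  let ?x = "\<lambda>j \<alpha>. if \<alpha> = e j then 1 else (0 :: 'k)"
  have "a i \<gamma> = (\<Sum>k<card (UNIV :: 'n set). cord_mult (?x (h k)) (w (h k) i) \<gamma>)" for i \<gamma>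
  proof -
    have share: "cord_mult (?x j) (w j i) \<gamma> = (if j = v \<gamma> then a i \<gamma> else 0)" for j
    proof (cases "\<gamma> j = 0")
      case True
      have "a i \<gamma> = 0" if "j = v \<gamma>"
      proof -
        have "\<gamma> = 0" using v[of \<gamma>] True that by auto
        then show ?thesis using a[of \<gamma> i] by simp
      qed
      then show ?thesis using True unfolding e_def cord_mult_variable by simp
    next
      case False
      then have "\<gamma> - e j + e j = \<gamma>" by (auto simp: e_def fun_eq_iff)
      then show ?thesis
        using False cord_mult_variable[of j "w j i" \<gamma>] unfolding e_def[symmetric] by (auto simp: w_def)
    qed
    have "a i \<gamma> = (\<Sum>j\<in>UNIV. cord_mult (?x j) (w j i) \<gamma>)" unfolding share by simp
    also have "\<dots> = (\<Sum>k<card (UNIV :: 'n set). cord_mult (?x (h k)) (w (h k) i) \<gamma>)"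
      by (rule sum.reindex_bij_betw[OF h, symmetric])
    finally show ?thesis .
  qed
  moreover have "(\<Sum>k<N. (\<lambda>i. cord_mult (?x (h k)) (w (h k) i))) i \<gamma>
      = (\<Sum>k<N. cord_mult (?x (h k)) (w (h k) i) \<gamma>)" for N :: nat and i \<gamma>
    by (induction N) auto
  ultimately have "a = (\<Sum>k<card (UNIV :: 'n set). (\<lambda>i. cord_mult (?x (h k)) (w (h k) i)))"
    by (auto simp: fun_eq_iff)
  then show ?thesis unfolding max_ideal_times_def using wM xI
    by (intro CollectI exI[of _ "card (UNIV :: 'n set)"] exI[of _ "\<lambda>k. ?x (h k)"] exI[of _ "\<lambda>k. w (h k)"]) auto
qed

lemma madic_supset: "(\<And>i \<alpha>. sum \<alpha> UNIV < l \<Longrightarrow> a i \<alpha> = 0) \<Longrightarrow> a \<in> madic l"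
proof (induction l arbitrary: a)
  case 0
  show ?case by (simp add: madic_def)
next
  case (Suc l)
  have "a \<in> max_ideal_times (madic l)" by (rule madic_Suc_supset[OF Suc.IH Suc.prems])
  then show ?case by (simp add: madic_def)
qed

lemma madic_iff: "a \<in> madic l \<longleftrightarrow> (\<forall>i \<alpha>. sum \<alpha> UNIV < l \<longrightarrow> a i \<alpha> = 0)"
  using madic_subset madic_supset by metis

lemma subspace_madic: "cords.subspace (madic l)"
  by (auto simp: cords.subspace_def madic_iff cords_scale_def)

text \<open>The projection onto \<open>W\<close> is polynomial in the coefficients since it differs from the identity only
  through the finitely many coefficients with index in \<open>M\<close>.\<close>

lemma subspace_nbhd_projection:
  fixes W :: "('m::finite, 'n::finite, 'k::field) cords set"
  assumes W: "cords.subspace W" and "madic_nbhd_0 W"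
  shows "\<exists>M v. finite M \<and>
    (\<forall>a. (\<lambda>i \<alpha>. a i \<alpha> + (\<Sum>j\<in>M. a (fst j) (snd j) * v j i \<alpha>)) \<in> W) \<and>
    (\<forall>a\<in>W. (\<lambda>i \<alpha>. a i \<alpha> + (\<Sum>j\<in>M. a (fst j) (snd j) * v j i \<alpha>)) = a) \<and>
    (\<forall>a\<in>W. \<forall>b. (\<forall>j\<in>M. a (fst j) (snd j) = b (fst j) (snd j)) \<longrightarrow> b \<in> W)"
proof -
  obtain l where l: "madic l \<subseteq> W" using assms(2) unfolding madic_nbhd_0_def by blast
  interpret cc: vector_space_pair "cords_scale :: 'k \<Rightarrow> ('m, 'n, 'k) cords \<Rightarrow> _" cords_scale ..
  have "Vector_Spaces.linear cords_scale cords_scale (id :: ('m, 'n, 'k) cords \<Rightarrow> _)"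
    by (rule cords.linear_id)
  \<comment> \<open>A purely algebraic projection onto \<open>W\<close>, given by a linear
    complement.\<close>
  then obtain \<pi> where \<pi>: "\<pi> ` UNIV \<subseteq> W" "Vector_Spaces.linear cords_scale cords_scale \<pi>"
    "\<forall>w\<in>W. \<pi> (id w) = w"
    using cc.linear_exists_left_inverse_on[of id W] W by auto
  interpret \<pi>: Vector_Spaces.linear cords_scale cords_scale \<pi> by (rule \<pi>(2))
  define M :: "('m \<times> ('n \<Rightarrow> nat)) set" where "M = UNIV \<times> {\<alpha>. sum \<alpha> UNIV < l}"
  define e :: "'m \<times> ('n \<Rightarrow> nat) \<Rightarrow> ('m, 'n, 'k) cords"
    where "e j = (\<lambda>i \<alpha>. if j = (i, \<alpha>) then 1 else 0)" for j
  define v where "v j = \<pi> (e j) - e j" for j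
  have finM: "finite M" unfolding M_def by (intro finite_cartesian_product finite_multi_index_less) simp
  have sum_app: "(\<Sum>j\<in>J. F j) i \<alpha> = (\<Sum>j\<in>J. F j i \<alpha>)"
    for J and F :: "'m \<times> ('n \<Rightarrow> nat) \<Rightarrow> ('m, 'n, 'k) cords" and i \<alpha>
    by (induction J rule: infinite_finite_induct) auto
  \<comment> \<open>Without its coefficients of degree below \<open>l\<close>, the tuple
    \<open>a\<close> lies in \<open>madic l\<close>, hence in \<open>W\<close>, where
    \<open>\<pi>\<close> is the identity. So \<open>\<pi> a - a\<close> is determined by these
    finitely many coefficients.\<close>
  have low: "a - (\<Sum>j\<in>M. cords_scale (a (fst j) (snd j)) (e j)) \<in> W" for a
  proof -
    have "(\<Sum>j\<in>M. cords_scale (a (fst j) (snd j)) (e j)) i \<alpha> = a i \<alpha>" if "sum \<alpha> UNIV < l" for i \<alpha>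
    proof -
      have "(\<Sum>j\<in>M. cords_scale (a (fst j) (snd j)) (e j)) i \<alpha> = (\<Sum>j\<in>M. if j = (i, \<alpha>) then a i \<alpha> else 0)"
        unfolding sum_app by (intro sum.cong) (auto simp: cords_scale_def e_def)
      moreover have "(i, \<alpha>) \<in> M" using that by (simp add: M_def)
      then have "(\<Sum>j\<in>M. if j = (i, \<alpha>) then a i \<alpha> else 0) = a i \<alpha>" using finM by simp
      ultimately show ?thesis by simp
    qed
    then show ?thesis using l by (auto simp: madic_iff intro!: subsetD[OF l])
  qed
  have eq: "\<pi> a = (\<lambda>i \<alpha>. a i \<alpha> + (\<Sum>j\<in>M. a (fst j) (snd j) * v j i \<alpha>))" for a
  proof -
    let ?s = "\<Sum>j\<in>M. cords_scale (a (fst j) (snd j)) (e j)"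
    have "\<pi> (a - ?s) = a - ?s" using \<pi>(3) low[of a] by simp
    then have "\<pi> a = a - ?s + \<pi> ?s" unfolding \<pi>.diff by (simp only: diff_eq_eq)
    also have "\<pi> ?s = (\<Sum>j\<in>M. cords_scale (a (fst j) (snd j)) (\<pi> (e j)))"
      by (simp add: \<pi>.sum \<pi>.scale)
    finally have "\<pi> a = a - ?s + (\<Sum>j\<in>M. cords_scale (a (fst j) (snd j)) (\<pi> (e j)))" .
    then show ?thesis
      by (simp add: fun_eq_iff sum_app cords_scale_def v_def right_diff_distrib sum_subtractf)
  qed
  show ?thesis
  proof (rule exI[of _ M], rule exI[of _ v], intro conjI allI ballI impI)
    show "finite M" by (rule finM)
  next
    fix a show "(\<lambda>i \<alpha>. a i \<alpha> + (\<Sum>j\<in>M. a (fst j) (snd j) * v j i \<alpha>)) \<in> W"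
      unfolding eq[symmetric] using \<pi>(1) by blast
  next
    fix a assume "a \<in> W"
    then show "(\<lambda>i \<alpha>. a i \<alpha> + (\<Sum>j\<in>M. a (fst j) (snd j) * v j i \<alpha>)) = a"
      unfolding eq[symmetric] using \<pi>(3) by simp
  next
    fix a b assume a: "a \<in> W" and ab: "\<forall>j\<in>M. a (fst j) (snd j) = b (fst j) (snd j)"
    have "b - a \<in> W" using ab by (auto simp: madic_iff M_def intro!: subsetD[OF l])
    then have "a + (b - a) \<in> W" using a W by (intro cords.subspace_add)
    then show "b \<in> W" by simp
  qed
qed

section \<open>Composition of regular families\<close>

lemma subvariety_Int: "subvariety q Z \<Longrightarrow> subvariety q Z' \<Longrightarrow> subvariety q (Z \<inter> Z')"
  unfolding subvariety_def
proof (elim exE conjE)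
  fix C G C' G' assume *: "closedin (subtopology zariski (affine_space q)) C"
    "openin (subtopology zariski (affine_space q)) G" "Z = C \<inter> G"
    "closedin (subtopology zariski (affine_space q)) C'"
    "openin (subtopology zariski (affine_space q)) G'" "Z' = C' \<inter> G'"
  show "\<exists>C G. closedin (subtopology zariski (affine_space q)) C \<and>
            openin (subtopology zariski (affine_space q)) G \<and> Z \<inter> Z' = C \<inter> G"
    using closedin_Int[OF *(1,4)] openin_Int[OF *(2,5)] *(3,6)
    by (intro exI[of _ "C \<inter> C'"] exI[of _ "G \<inter> G'"]) auto
qed

lemma subvariety_Int_INT:
  "finite J \<Longrightarrow> subvariety q Z \<Longrightarrow> (\<And>j. j \<in> J \<Longrightarrow> subvariety q (Z' j)) \<Longrightarrow> subvariety q (Z \<inter> (\<Inter>j\<in>J. Z' j))"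
proof (induction J rule: finite_induct)
  case (insert j J)
  have "subvariety q (Z' j \<inter> (Z \<inter> (\<Inter>j\<in>J. Z' j)))"
    by (rule subvariety_Int) (use insert in auto)
  then show ?case by (simp add: Int_ac)
qed simp

lemma subvariety_subset: "subvariety q Z \<Longrightarrow> Z \<subseteq> affine_space q"
  unfolding subvariety_def by (auto dest!: openin_subset)

lemma subvariety_empty: "subvariety q {}"
  unfolding subvariety_def by (intro exI[of _ "{}"]) simp

lemma regular_scalar_family_empty: "regular_scalar_family q {} \<phi>"
  unfolding regular_scalar_family_def
  using subvariety_empty by (intro exI[of _ "{}"]) (auto intro: zariski_regularI)

lemma regular_scalar_family_TimesI:
  assumes "subvariety q Z" "S \<subseteq> Z" "zariski_regular (coords ` (Z \<times> Y)) \<gamma>"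
    "\<And>s a. s \<in> S \<Longrightarrow> a \<in> Y \<Longrightarrow> \<phi> s a = \<gamma> (coords (s, a))"
  shows "regular_scalar_family q (S \<times> Y) \<phi>"
  unfolding regular_scalar_family_def
proof (intro exI conjI)
  show "subvariety q Z" by fact
  show "fst ` (S \<times> Y) \<subseteq> Z" using assms(2) by auto
  show "zariski_regular (coords ` (Z \<times> snd ` (S \<times> Y))) \<gamma>"
    by (rule zariski_regular_subset[OF assms(3)]) auto
  show "\<forall>(s, a)\<in>S \<times> Y. \<phi> s a = \<gamma> (coords (s, a))" using assms(4) by auto
qed

text \<open>Both factors are nonempty because the projections of an empty product forget the other
  factor.\<close>

lemma regular_scalar_family_TimesE:
  assumes "regular_scalar_family q (S \<times> Y) \<phi>" "S \<noteq> {}" "Y \<noteq> {}"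
  shows "\<exists>Z \<gamma>. subvariety q Z \<and> S \<subseteq> Z \<and> zariski_regular (coords ` (Z \<times> Y)) \<gamma> \<and>
    (\<forall>s\<in>S. \<forall>a\<in>Y. \<phi> s a = \<gamma> (coords (s, a)))"
proof -
  have "fst ` (S \<times> Y) = S" "snd ` (S \<times> Y) = Y" using assms by auto
  then show ?thesis using assms(1) unfolding regular_scalar_family_def by auto
qed

lemma regular_scalar_family_diff:
  assumes "regular_scalar_family q (S \<times> Y) \<phi>" "regular_scalar_family q (S \<times> Y) \<psi>"
    and ne: "S \<noteq> {}" "Y \<noteq> {}"
  shows "regular_scalar_family q (S \<times> Y) (\<lambda>s a. \<phi> s a - \<psi> s a)"
proof -
  obtain Z \<gamma> where 1: "subvariety q Z" "S \<subseteq> Z" "zariski_regular (coords ` (Z \<times> Y)) \<gamma>"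
    "\<forall>s\<in>S. \<forall>a\<in>Y. \<phi> s a = \<gamma> (coords (s, a))"
    using regular_scalar_family_TimesE[OF assms(1) ne] by (elim exE conjE)
  obtain Z' \<gamma>' where 2: "subvariety q Z'" "S \<subseteq> Z'" "zariski_regular (coords ` (Z' \<times> Y)) \<gamma>'"
    "\<forall>s\<in>S. \<forall>a\<in>Y. \<psi> s a = \<gamma>' (coords (s, a))"
    using regular_scalar_family_TimesE[OF assms(2) ne] by (elim exE conjE)
  show ?thesis
  proof (rule regular_scalar_family_TimesI[OF subvariety_Int[OF 1(1) 2(1)]])
    show "S \<subseteq> Z \<inter> Z'" using 1 2 by auto
    show "zariski_regular (coords ` ((Z \<inter> Z') \<times> Y)) (\<lambda>x. \<gamma> x - \<gamma>' x)"
      by (intro zariski_regular_diff zariski_regular_subset[OF 1(3)] zariski_regular_subset[OF 2(3)]) auto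
  qed (use 1 2 in auto)
qed

text \<open>Finite dependence of \<open>\<gamma>\<close> means that only finitely many coefficients
  of \<open>H\<close> have to be extended beyond \<open>S\<close>, so a finite intersection of
  subvarieties suffices. The other coefficients are replaced by 0, and the projection onto
  \<open>Y\<close> repairs membership in \<open>Y\<close>.\<close>

lemma regular_scalar_family_compose:
  fixes Y :: "('m::finite, 'n::finite, 'k::field_char_0) cords set"
    and H :: "(nat \<Rightarrow> 'k) \<Rightarrow> ('p, 'n, 'k) cords \<Rightarrow> ('m, 'n, 'k) cords"
  assumes \<phi>: "regular_scalar_family q (S \<times> Y) \<phi>" and H: "regular_family q (S \<times> X) H"
    and HY: "\<And>s c. s \<in> S \<Longrightarrow> c \<in> X \<Longrightarrow> H s c \<in> Y"
    and Y: "cords.subspace Y" "madic_nbhd_0 Y"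
    and ne: "S \<noteq> {}" "X \<noteq> {}"
  shows "regular_scalar_family q (S \<times> X) (\<lambda>s c. \<phi> s (H s c))"
proof -
  have "0 \<in> Y" using Y(1) by (rule cords.subspace_0)
  then have "Y \<noteq> {}" by auto
  from regular_scalar_family_TimesE[OF \<phi> ne(1) this]
  obtain Z0 \<gamma> where Z0: "subvariety q Z0" "S \<subseteq> Z0" and \<gamma>: "zariski_regular (coords ` (Z0 \<times> Y)) \<gamma>"
    and \<phi>\<gamma>: "\<forall>s\<in>S. \<forall>a\<in>Y. \<phi> s a = \<gamma> (coords (s, a))" by (elim exE conjE)
  from regular_finite_dependence[OF subvariety_subset[OF Z0(1)] Y(1) \<gamma>]
  obtain N where N: "finite N" and dep: "\<forall>s\<in>Z0. \<forall>a\<in>Y. \<forall>b\<in>Y.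
    (\<forall>(i, \<alpha>)\<in>N. a i \<alpha> = b i \<alpha>) \<longrightarrow> \<gamma> (coords (s, a)) = \<gamma> (coords (s, b))" by (elim exE conjE)
  from subspace_nbhd_projection[OF Y] obtain M v where M: "finite M"
    and projY: "\<forall>a. (\<lambda>i \<alpha>. a i \<alpha> + (\<Sum>j\<in>M. a (fst j) (snd j) * v j i \<alpha>)) \<in> Y"
    and proj_id: "\<forall>a\<in>Y. (\<lambda>i \<alpha>. a i \<alpha> + (\<Sum>j\<in>M. a (fst j) (snd j) * v j i \<alpha>)) = a"
    and agreeY: "\<forall>a\<in>Y. \<forall>b. (\<forall>j\<in>M. a (fst j) (snd j) = b (fst j) (snd j)) \<longrightarrow> b \<in> Y"
    by (elim exE conjE)
  \<comment> \<open>\<open>N\<close> determines the value of \<open>\<gamma>\<close>; agreement on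
    \<open>M\<close> with an element of \<open>Y\<close> guarantees membership in
    \<open>Y\<close>.\<close>
  define J where "J = N \<union> M"
  have J: "finite J" unfolding J_def using N M by simp
  have "\<forall>j. \<exists>Z \<eta>. subvariety q Z \<and> S \<subseteq> Z \<and> zariski_regular (coords ` (Z \<times> X)) \<eta> \<and>
    (\<forall>s\<in>S. \<forall>c\<in>X. H s c (fst j) (snd j) = \<eta> (coords (s, c)))"
    using H ne unfolding regular_family_def by (intro allI regular_scalar_family_TimesE) auto
  then obtain Z \<eta> where Z: "\<And>j. subvariety q (Z j)" "\<And>j. S \<subseteq> Z j"
    and \<eta>: "\<And>j. zariski_regular (coords ` (Z j \<times> X)) (\<eta> j)"
    and H\<eta>: "\<And>j s c. s \<in> S \<Longrightarrow> c \<in> X \<Longrightarrow> H s c (fst j) (snd j) = \<eta> j (coords (s, c))" by metis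
  define Z' where "Z' = Z0 \<inter> (\<Inter>j\<in>J. Z j)"
  define w where "w x = (\<lambda>i \<alpha>. if (i, \<alpha>) \<in> J then \<eta> (i, \<alpha>) x else 0)" for x
  (* The point \<open>b (coords (s, c))\<close> agrees with \<open>H s c\<close> on \<open>N\<close> for \<open>s \<in> S\<close>, and lies in \<open>Y\<close> even for \<open>s \<notin> S\<close>. *)
  define b where "b x = (\<lambda>i \<alpha>. w x i \<alpha> + (\<Sum>j\<in>M. w x (fst j) (snd j) * v j i \<alpha>))" for x
  define \<sigma> where "\<sigma> x = coords (\<lambda>n. x (Inl n), b x)" for x
  have \<sigma>_coords: "\<sigma> (coords (s, c)) = coords (s, b (coords (s, c)))" for s c
    unfolding \<sigma>_def by simp
  have bY: "b x \<in> Y" for x unfolding b_def by (rule projY[rule_format])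
  have reg_w: "zariski_regular (coords ` (Z' \<times> X)) (\<lambda>x. w x i \<alpha>)" for i \<alpha>
  proof (cases "(i, \<alpha>) \<in> J")
    case True
    have "zariski_regular (coords ` (Z' \<times> X)) (\<eta> (i, \<alpha>))"
      by (rule zariski_regular_subset[OF \<eta>[of "(i, \<alpha>)"]]) (use True Z'_def in auto)
    then show ?thesis using True by (simp add: w_def)
  qed (simp add: w_def zariski_regular_const)
  have reg_\<sigma>: "zariski_regular (coords ` (Z' \<times> X)) (\<lambda>x. \<sigma> x u)" for u
  proof (cases u)
    case (Inl n)
    then show ?thesis by (simp add: \<sigma>_def zariski_regular_poly_fun poly_funs.coord)
  next
    case (Inr p)
    obtain i \<alpha> where "p = (i, \<alpha>)" by (cases p)
    then show ?thesis unfolding Inr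
      by (simp add: \<sigma>_def b_def)
        (intro zariski_regular_add zariski_regular_sum zariski_regular_mult zariski_regular_const reg_w)
  qed
  show ?thesis
  proof (rule regular_scalar_family_TimesI)
    show "subvariety q Z'" unfolding Z'_def using J Z0(1) Z(1) by (rule subvariety_Int_INT)
    show "S \<subseteq> Z'" unfolding Z'_def using Z0(2) Z(2) by auto
    show "zariski_regular (coords ` (Z' \<times> X)) (\<lambda>x. \<gamma> (\<sigma> x))"
    proof (rule zariski_regular_comp[OF \<gamma> _ reg_\<sigma>])
      show "\<sigma> ` coords ` (Z' \<times> X) \<subseteq> coords ` (Z0 \<times> Y)"
        using bY by (auto simp: \<sigma>_coords Z'_def)
    qed
    fix s c assume sc: "s \<in> S" "c \<in> X"
    let ?x = "coords (s, c)"
    have w: "w ?x i \<alpha> = H s c i \<alpha>" if "(i, \<alpha>) \<in> J" for i \<alpha>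
      using that H\<eta>[OF sc, of "(i, \<alpha>)"] by (simp add: w_def)
    \<comment> \<open>For \<open>s \<in> S\<close> the truncated tuple is already in
      \<open>Y\<close>, so the projection leaves it unchanged.\<close>
    have "w ?x \<in> Y" by (rule agreeY[rule_format, OF HY[OF sc]]) (auto simp: w J_def)
    then have "b ?x = w ?x" unfolding b_def by (rule proj_id[rule_format])
    then have "\<forall>(i, \<alpha>)\<in>N. H s c i \<alpha> = b ?x i \<alpha>" using w by (auto simp: J_def)
    moreover have "s \<in> Z0" using sc Z0 by auto
    ultimately have "\<gamma> (coords (s, H s c)) = \<gamma> (coords (s, b ?x))"
      using dep HY[OF sc] bY by blast
    then show "\<phi> s (H s c) = \<gamma> (\<sigma> ?x)" using \<phi>\<gamma> sc HY[OF sc] by (simp add: \<sigma>_coords)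
  qed
qed

lemma regular_family_compose:
  fixes Y :: "('m::finite, 'n::finite, 'k::field_char_0) cords set"
  assumes "regular_family q (S \<times> Y) F" "regular_family q (S \<times> X) H"
    and "\<And>s c. s \<in> S \<Longrightarrow> c \<in> X \<Longrightarrow> H s c \<in> Y"
    and "cords.subspace Y" "madic_nbhd_0 Y" "S \<noteq> {}" "X \<noteq> {}"
  shows "regular_family q (S \<times> X) (\<lambda>s c. F s (H s c))"
  using regular_scalar_family_compose[OF _ assms(2-7)] assms(1)
  unfolding regular_family_def[of _ _ F] regular_family_def[of _ _ "\<lambda>s c. F s (H s c)"] by blast

lemma regular_family_diff:
  assumes "regular_family q (S \<times> Y) F" "regular_family q (S \<times> Y) G" "S \<noteq> {}" "Y \<noteq> {}"
  shows "regular_family q (S \<times> Y) (\<lambda>s a. F s a - G s a)"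
  using assms regular_scalar_family_diff unfolding regular_family_def by fastforce

lemma regular_family_cong:
  assumes "regular_family q (S \<times> Y) F" "\<And>s a. s \<in> S \<Longrightarrow> a \<in> Y \<Longrightarrow> F s a = G s a"
  shows "regular_family q (S \<times> Y) G"
proof -
  have "(\<forall>(s, a)\<in>S \<times> Y. F s a i \<alpha> = \<gamma> (coords (s, a))) \<longleftrightarrow> (\<forall>(s, a)\<in>S \<times> Y. G s a i \<alpha> = \<gamma> (coords (s, a)))"
    for i \<alpha> \<gamma> using assms(2) by auto
  then show ?thesis using assms(1) unfolding regular_family_def regular_scalar_family_def by simp
qed

section \<open>Contractive maps\<close>

text \<open>Orders are integers or infinite, so the strict inequality gains a full degree of
  agreement.\<close>

lemma contractive_agree:
  assumes "cords_ord (T a - T b) > cords_ord (a - b) \<or> a = b"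
    and "\<And>i \<alpha>. sum \<alpha> UNIV < k \<Longrightarrow> a i \<alpha> = b i \<alpha>" and "sum \<alpha> UNIV < Suc k"
  shows "T a i \<alpha> = T b i \<alpha>"
proof (cases "a = b")
  case False
  have "enat k \<le> cords_ord (a - b)" using assms(2) by (simp add: cords_ord_ge_iff)
  also have "\<dots> < cords_ord (T a - T b)" using assms(1) False by simp
  finally have "enat (Suc k) \<le> cords_ord (T a - T b)" by (simp add: Suc_ile_eq)
  then show ?thesis using assms(3) by (simp add: cords_ord_ge_iff)
qed simp

text \<open>Every iteration fixes one more degree, so a coefficient of degree d is final from
  iterate d + 1 on. The limit \<open>x\<close> takes each coefficient from the first iterate known
  to be final there, which makes it a finite composition.\<close>

lemma contractive_fixed_point:
  fixes T :: "('m::finite, 'n::finite, 'k::field) cords \<Rightarrow> ('m, 'n, 'k) cords"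
  assumes z: "z \<in> madic l"
    and TU: "\<And>a. a \<in> madic l \<Longrightarrow> T a \<in> madic l"
    and contr: "\<And>a b. a \<in> madic l \<Longrightarrow> b \<in> madic l \<Longrightarrow> a \<noteq> b \<Longrightarrow> cords_ord (T a - T b) > cords_ord (a - b)"
  defines "x \<equiv> \<lambda>i \<alpha>. (T ^^ Suc (sum \<alpha> UNIV)) z i \<alpha>"
  shows "x \<in> madic l" and "T x = x"
proof -
  have it: "(T ^^ k) z \<in> madic l" for k
    by (induction k) (simp_all add: z TU)
  have step: "(T ^^ k) z i \<alpha> = (T ^^ Suc k) z i \<alpha>" if "sum \<alpha> UNIV < k" for k i \<alpha>
    using that
  proof (induction k arbitrary: i \<alpha>)
    case (Suc k)
    have "T ((T ^^ k) z) i \<alpha> = T ((T ^^ Suc k) z) i \<alpha>"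
      by (rule contractive_agree[where T = T, OF _ Suc.IH Suc.prems]) (use contr it in blast)
    then show ?case by simp
  qed simp
  have agree: "(T ^^ k) z i \<alpha> = x i \<alpha>" if "sum \<alpha> UNIV < k" for k i \<alpha>
    using that
  proof (induction k)
    case (Suc k)
    show ?case
    proof (cases "sum \<alpha> UNIV = k")
      case True
      then show ?thesis by (simp add: x_def)
    next
      case False
      then show ?thesis using Suc step[of \<alpha> k i] by simp
    qed
  qed simp
  show xU: "x \<in> madic l"
    using it unfolding x_def madic_iff by blast
  show "T x = x"
  proof (intro ext)
    fix i and \<alpha> :: "'n \<Rightarrow> nat"
    let ?k = "Suc (sum \<alpha> UNIV)"
    have "T x i \<alpha> = T ((T ^^ ?k) z) i \<alpha>"
      by (rule contractive_agree[where T = T and k = ?k]) (use contr xU it agree in \<open>auto simp del: funpow.simps\<close>)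
    also have "\<dots> = (T ^^ Suc ?k) z i \<alpha>" by simp
    also have "\<dots> = x i \<alpha>" by (rule agree) simp
    finally show "T x i \<alpha> = x i \<alpha>" .
  qed
qed

section \<open>The right inverse of the family\<close>

theorem theorem4p4:
  fixes q l :: nat
    and S :: "(nat \<Rightarrow> 'k::field_char_0) set"
    and U W :: "('m::finite, 'n::finite, 'k) cords set"
    and f \<L> h \<L>inv :: "(nat \<Rightarrow> 'k) \<Rightarrow> ('m, 'n, 'k) cords \<Rightarrow> ('m, 'n, 'k) cords"
  assumes "constructible q S"
    and "U = madic l"
    and "cords.subspace W" and "madic_nbhd_0 W"
    and "regular_family q (S \<times> U) f"
    and "\<forall>s\<in>S. f s 0 = 0"
    and "\<forall>s\<in>S. \<forall>a\<in>U. f s a = \<L> s a + h s a"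
    and "\<forall>s\<in>S. \<forall>a\<in>U. f s a \<in> W \<and> \<L> s a \<in> W \<and> h s a \<in> W"
    and "regular_family q (S \<times> U) \<L>"
    and "\<forall>s\<in>S. linear_on U (\<L> s)"
    and "regular_family q (S \<times> W) \<L>inv"
    and "right_inverse_family S U (\<lambda>_. W) \<L> \<L>inv"
    and "contractive_family S U (\<lambda>s. \<L>inv s \<circ> h s)"
  shows "\<exists>g :: (nat \<Rightarrow> 'k) \<Rightarrow> ('m, 'n, 'k) cords \<Rightarrow> ('m, 'n, 'k) cords.
           regular_family q (SIGMA s:S. f s ` U) g \<and>
           right_inverse_family S U (\<lambda>s. f s ` U) f g"
proof (cases "S = {}")
  case True
  then show ?thesis
    by (auto simp: regular_family_def regular_scalar_family_empty right_inverse_family_def)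
next
  case False
  note U = assms(2)
  have subU: "cords.subspace U" and nbhdU: "madic_nbhd_0 U"
    unfolding U madic_nbhd_0_def by (rule subspace_madic) blast
  have U0: "0 \<in> U" using subU by (rule cords.subspace_0)
  have W0: "0 \<in> W" using assms(3) by (rule cords.subspace_0)
  have Linv: "\<L>inv s c \<in> U" "\<L> s (\<L>inv s c) = c" if "s \<in> S" "c \<in> W" for s c
    using assms(12) that unfolding right_inverse_family_def by auto
  have hW: "h s a \<in> W" and fW: "f s a \<in> W" if "s \<in> S" "a \<in> U" for s a using assms(8) that by auto
  \<comment> \<open>The equation to solve is \<open>\<L> s a = c - h s a\<close>. Linearity is
    assumed of \<open>\<L>\<close> and not of \<open>\<L>inv\<close>, so the two values of
    \<open>\<L>inv\<close> are subtracted instead of applying it to the difference; the contraction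
    hypothesis then transfers to \<open>T\<close> directly.\<close>
  define T where "T s c a = \<L>inv s c - \<L>inv s (h s a)" for s c a
  have TU: "T s c a \<in> U" if "s \<in> S" "c \<in> W" "a \<in> U" for s c a
    unfolding T_def using that subU hW Linv by (intro cords.subspace_diff) auto
  have contr: "cords_ord (T s c a - T s c b) > cords_ord (a - b)"
    if "s \<in> S" "a \<in> U" "b \<in> U" "a \<noteq> b" for s c a b
  proof -
    have neg: "cords_ord (- d) = cords_ord d" for d :: "('m, 'n, 'k) cords"
      by (simp add: cords_ord_def cord_ord_def)
    have "T s c a - T s c b = - (\<L>inv s (h s a) - \<L>inv s (h s b))" by (simp add: T_def)
    then have "cords_ord (T s c a - T s c b) = cords_ord (\<L>inv s (h s a) - \<L>inv s (h s b))"
      by (simp only: neg)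
    then show ?thesis
      using assms(13) that by (simp add: contractive_family_def)
  qed
  define g where "g s c = (\<lambda>i \<alpha>. (T s c ^^ Suc (sum \<alpha> UNIV)) 0 i \<alpha>)" for s c
  have g: "g s c \<in> U" "T s c (g s c) = g s c" if sc: "s \<in> S" "c \<in> W" for s c
    using contractive_fixed_point[of 0 l "T s c"] U0 TU[OF sc] contr[OF sc(1)]
    unfolding g_def U by blast+
  have fg: "f s (g s c) = c" if sc: "s \<in> S" "c \<in> W" for s c
  proof -
    note gU = g(1)[OF sc]
    have hg: "h s (g s c) \<in> W" using hW sc gU by simp
    have lin: "\<L> s (a - b) = \<L> s a - \<L> s b" if "a \<in> U" "b \<in> U" for a b
    proof -
      have "a - b \<in> U" using subU that by (intro cords.subspace_diff)
      then have "\<L> s ((a - b) + b) = \<L> s (a - b) + \<L> s b"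
        using assms(10) sc(1) that(2) unfolding linear_on_def by blast
      then show ?thesis by simp
    qed
    have "\<L> s (T s c (g s c)) = c - h s (g s c)"
      unfolding T_def using lin[OF Linv(1)[OF sc] Linv(1)[OF sc(1) hg]] Linv(2) sc hg by simp
    then show ?thesis using assms(7) sc gU g(2)[OF sc] by simp
  qed
  \<comment> \<open>Hence the domain of \<open>g\<close> is the product \<open>S \<times> W\<close>,
    to which the composition results apply.\<close>
  have image: "f s ` U = W" if "s \<in> S" for s
    using fW[OF that] fg[OF that] g(1)[OF that] by (metis image_subsetI image_eqI subsetI subset_antisym)
  have reg_h: "regular_family q (S \<times> U) h"
    by (rule regular_family_cong[OF regular_family_diff[OF assms(5,9)]]) (use False U0 assms(7) in auto)
  have iter: "(T s c ^^ k) 0 \<in> U" if "s \<in> S" "c \<in> W" for s c k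
  proof (induction k)
    case 0
    show ?case unfolding funpow.simps id_apply by (rule U0)
  qed (simp add: TU that)
  have reg_iter: "regular_family q (S \<times> W) (\<lambda>s c. (T s c ^^ k) 0)" for k
  proof (induction k)
    case 0
    \<comment> \<open>The constant family 0, as the difference of a regular family with
      itself.\<close>
    have "regular_family q (S \<times> W) (\<lambda>s c. \<L>inv s c - \<L>inv s c)"
      by (rule regular_family_diff[OF assms(11,11)]) (use False W0 in auto)
    then show ?case unfolding funpow.simps id_apply diff_self .
  next
    case (Suc k)
    have "regular_family q (S \<times> W) (\<lambda>s c. h s ((T s c ^^ k) 0))"
      by (rule regular_family_compose[OF reg_h Suc.IH iter subU nbhdU]) (use False W0 in auto)
    \<comment> \<open>This composition passes through \<open>W\<close>, which need not be of the
      form \<open>madic l\<close>; composition is therefore available for all linear neighbourhoods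
      of 0.\<close>
    then have "regular_family q (S \<times> W) (\<lambda>s c. \<L>inv s (h s ((T s c ^^ k) 0)))"
      by (rule regular_family_compose[OF assms(11) _ _ assms(3,4)]) (use False W0 hW iter in auto)
    then have "regular_family q (S \<times> W) (\<lambda>s c. \<L>inv s c - \<L>inv s (h s ((T s c ^^ k) 0)))"
      by (rule regular_family_diff[OF assms(11)]) (use False W0 in auto)
    then show ?case unfolding funpow.simps comp_apply T_def .
  qed
  have "(SIGMA s:S. f s ` U) = S \<times> W" using image by (intro Sigma_cong) auto
  moreover have "regular_family q (S \<times> W) g"
    unfolding regular_family_def
  proof (intro allI)
    fix i \<alpha>
    show "regular_scalar_family q (S \<times> W) (\<lambda>s a. g s a i \<alpha>)"
      using reg_iter[of "Suc (sum \<alpha> UNIV)"] unfolding regular_family_def g_def by blast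
  qed
  moreover have "right_inverse_family S U (\<lambda>s. f s ` U) f g"
    unfolding right_inverse_family_def using image g(1) fg by simp
  ultimately show ?thesis by metis
qed

end
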